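(* Let $G$ be a group generated as a monoid by a subset $A\subseteq G$ that is closed under $G$-conjugation, and let $c\in G$. Suppose that $\mathrm{Red}_A(c)$ is finite, that there exists a $c$-compatible order $\prec$ of $A_c$, and that $\mathcal{P}_c(G,A)$ is totally well-covered with respect to $\prec$. Then $\mathcal{P}_c(G,A)$ is chain-connected, Hurwitz-connected and shellable.
   Context: For $x\in G$, $\ell_A(x)$ is the least $k\ge 0$ such that $x=a_1\cdots a_k$ with all $a_i\in A$. Such a factorization with $k=\ell_A(x)$ is a reduced $A$-factorization; $\mathrm{Red}_A(x)$ is the set of these, written as tuples $(a_1,\dots,a_k)$. The $A$-prefix order is $x\le_A y$ iff $\ell_A(x)+\ell_A(x^{-1}y)=\ell_A(y)$; write $x\lessdot_A y$ for a cover relation. The factorization poset $\mathcal{P}_c=\mathcal{P}_c(G,A)$ is the interval $[e,c]_A=\{x\in G: e\le_A x\le_A c\}$ with the order $\le_A$; it is bounded and graded. $A_c=\{a\in A: a\le_A c\}$. A linear order $\prec$ on $A_c$ is $c$-compatible if every $g\le_A c$ with $\ell_A(g)=2$ has exactly one reduced $A$-factorization $(a,b)$ with $a\preceq b$. For $a\in A_c$ let $F_\prec(a;c)=\{g\in G: a\lessdot_A g\le_A c$ and there is $a'\in A_c$ with $a'\prec a$ and $a'\lessdot_A g\}$. $\mathcal{P}_c$ is well-covered with respect to $\prec$ if $F_\prec(a;c)=\emptyset$ holds exactly when $a=\min_\prec A_c$. It is totally well-covered with respect to $\prec$ if for every $g\in\mathcal{P}_c$ the poset $\mathcal{P}_g$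 is well-covered with respect to the restriction of $\prec$ to $A_g$. For a finite bounded graded poset, the chain graph has the maximal chains as vertices, two being adjacent when they differ in exactly one element; the poset is chain-connected if this graph is connected. With $n=\ell_A(c)$, the braid group $B_n$ acts on $\mathrm{Red}_A(c)$ (Hurwitz action) by $\sigma_i\cdot(a_1,\dots,a_n)=(a_1,\dots,a_{i-1},a_{i+1},a_{i+1}^{-1}a_ia_{i+1},a_{i+2},\dots,a_n)$. $\mathcal{P}_c$ is Hurwitz-connected if this action is transitive. A finite bounded graded poset is shellable if there is a linear order $\prec$ on its set of maximal chains such that whenever $M\prec M'$ there exist a maximal chain $N\prec M'$ and an element $x\in M'$ with $M\cap M'\subseteq N\cap M'=M'\setminus\{x\}$. *)

theory Defs
  imports "HOL-Algebra.Group_Action"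
begin

section \<open>Reduced factorizations and the prefix order\<close>

definition word_prod :: "('a, 'b) monoid_scheme \<Rightarrow> 'a list \<Rightarrow> 'a" where
  "word_prod G as = foldr (\<otimes>\<^bsub>G\<^esub>) as \<one>\<^bsub>G\<^esub>"

definition word_length :: "('a, 'b) monoid_scheme \<Rightarrow> 'a set \<Rightarrow> 'a \<Rightarrow> nat" where
  "word_length G A x = (LEAST k. \<exists>as. length as = k \<and> set as \<subseteq> A \<and> word_prod G as = x)"

definition Red :: "('a, 'b) monoid_scheme \<Rightarrow> 'a set \<Rightarrow> 'a \<Rightarrow> 'a list set" where
  "Red G A x = {as. set as \<subseteq> A \<and> word_prod G as = x \<and> length as = word_length G A x}"

definition prefix_le :: "('a, 'b) monoid_scheme \<Rightarrow> 'a set \<Rightarrow> 'a \<Rightarrow> 'a \<Rightarrow> bool" where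
  "prefix_le G A x y \<longleftrightarrow> x \<in> carrier G \<and> y \<in> carrier G \<and>
     word_length G A x + word_length G A (inv\<^bsub>G\<^esub> x \<otimes>\<^bsub>G\<^esub> y) = word_length G A y"

definition prefix_cover :: "('a, 'b) monoid_scheme \<Rightarrow> 'a set \<Rightarrow> 'a \<Rightarrow> 'a \<Rightarrow> bool" where
  "prefix_cover G A x y \<longleftrightarrow> prefix_le G A x y \<and> x \<noteq> y \<and>
     \<not> (\<exists>z. prefix_le G A x z \<and> prefix_le G A z y \<and> z \<noteq> x \<and> z \<noteq> y)"

definition factor_poset :: "('a, 'b) monoid_scheme \<Rightarrow> 'a set \<Rightarrow> 'a \<Rightarrow> 'a set" where
  "factor_poset G A c =
     {x \<in> carrier G. prefix_le G A \<one>\<^bsub>G\<^esub> x \<and> prefix_le G A x c}"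

definition factor_order :: "('a, 'b) monoid_scheme \<Rightarrow> 'a set \<Rightarrow> 'a \<Rightarrow> 'a rel" where
  "factor_order G A c =
     {(x, y). x \<in> factor_poset G A c \<and> y \<in> factor_poset G A c \<and> prefix_le G A x y}"

definition gens_below :: "('a, 'b) monoid_scheme \<Rightarrow> 'a set \<Rightarrow> 'a \<Rightarrow> 'a set" where
  "gens_below G A c = {a \<in> A. prefix_le G A a c}"


section \<open>Compatible orders and well-coveredness\<close>

text \<open>A linear order on the generators below \<open>c\<close> is given by its reflexive relation \<open>r\<close>
  (\<open>linear_order_on\<close>); its strict part is \<open>(a, b) \<in> r \<and> a \<noteq> b\<close>.\<close>

definition compatible_order ::
  "('a, 'b) monoid_scheme \<Rightarrow> 'a set \<Rightarrow> 'a \<Rightarrow> 'a rel \<Rightarrow> bool" where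
  "compatible_order G A c r \<longleftrightarrow>
     linear_order_on (gens_below G A c) r \<and>
     (\<forall>g. prefix_le G A g c \<and> word_length G A g = 2 \<longrightarrow>
        (\<exists>!p. case p of (a, b) \<Rightarrow> [a, b] \<in> Red G A g \<and> (a, b) \<in> r))"

definition cover_set ::
  "('a, 'b) monoid_scheme \<Rightarrow> 'a set \<Rightarrow> 'a \<Rightarrow> 'a rel \<Rightarrow> 'a \<Rightarrow> 'a set" where
  "cover_set G A c r a =
     {g. prefix_cover G A a g \<and> prefix_le G A g c \<and>
         (\<exists>a' \<in> gens_below G A c. (a', a) \<in> r \<and> a' \<noteq> a \<and> prefix_cover G A a' g)}"

definition well_covered ::
  "('a, 'b) monoid_scheme \<Rightarrow> 'a set \<Rightarrow> 'a \<Rightarrow> 'a rel \<Rightarrow> bool" where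
  "well_covered G A c r \<longleftrightarrow>
     (\<forall>a \<in> gens_below G A c.
        cover_set G A c r a = {} \<longleftrightarrow> (\<forall>b \<in> gens_below G A c. (a, b) \<in> r))"

definition totally_well_covered ::
  "('a, 'b) monoid_scheme \<Rightarrow> 'a set \<Rightarrow> 'a \<Rightarrow> 'a rel \<Rightarrow> bool" where
  "totally_well_covered G A c r \<longleftrightarrow>
     (\<forall>g \<in> factor_poset G A c. well_covered G A g (Restr r (gens_below G A g)))"


section \<open>Chain-connected and shellable posets\<close>

text \<open>A poset is a carrier set \<open>P\<close> together with its reflexive order relation \<open>r\<close>.  For finite
  bounded posets, graded means that all maximal chains have the same number of elements.\<close>

definition max_chains :: "'a set \<Rightarrow> 'a rel \<Rightarrow> 'a set set" where
  "max_chains P r = {M. pred_on.maxchain P (\<lambda>x y. (x, y) \<in> r) M}"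

definition finite_bounded_graded :: "'a set \<Rightarrow> 'a rel \<Rightarrow> bool" where
  "finite_bounded_graded P r \<longleftrightarrow>
     finite P \<and> partial_order_on P r \<and>
     (\<exists>b \<in> P. \<forall>x \<in> P. (b, x) \<in> r) \<and> (\<exists>t \<in> P. \<forall>x \<in> P. (x, t) \<in> r) \<and>
     (\<forall>M \<in> max_chains P r. \<forall>N \<in> max_chains P r. card M = card N)"

definition chain_graph :: "'a set \<Rightarrow> 'a rel \<Rightarrow> 'a set rel" where
  "chain_graph P r =
     {(M, N). M \<in> max_chains P r \<and> N \<in> max_chains P r \<and> card (M - N) = 1 \<and> card (N - M) = 1}"

definition chain_connected :: "'a set \<Rightarrow> 'a rel \<Rightarrow> bool" where
  "chain_connected P r \<longleftrightarrow>
     finite_bounded_graded P r \<and>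
     (\<forall>M \<in> max_chains P r. \<forall>N \<in> max_chains P r. (M, N) \<in> (chain_graph P r)\<^sup>*)"

definition shellable :: "'a set \<Rightarrow> 'a rel \<Rightarrow> bool" where
  "shellable P r \<longleftrightarrow>
     finite_bounded_graded P r \<and>
     (\<exists>R. linear_order_on (max_chains P r) R \<and>
        (\<forall>M M'. (M, M') \<in> R \<and> M \<noteq> M' \<longrightarrow>
           (\<exists>N x. (N, M') \<in> R \<and> N \<noteq> M' \<and> x \<in> M' \<and>
              M \<inter> M' \<subseteq> N \<inter> M' \<and> N \<inter> M' = M' - {x})))"


section \<open>The braid group and the Hurwitz action\<close>

text \<open>The braid group on \<open>n\<close> strands is given by its Artin presentation.  Since list positions
  count from 0, the letter \<open>(i, True)\<close> stands for \<open>\<sigma>\<close> with index \<open>i + 1\<close>, and \<open>(i, False)\<close> for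
  its inverse.\<close>

type_synonym braid_word = "(nat \<times> bool) list"

definition braid_words :: "nat \<Rightarrow> braid_word set" where
  "braid_words n = lists {(i, s). Suc i < n}"

inductive braid_equiv :: "nat \<Rightarrow> braid_word \<Rightarrow> braid_word \<Rightarrow> bool" for n where
  refl: "w \<in> braid_words n \<Longrightarrow> braid_equiv n w w"
| sym: "braid_equiv n u v \<Longrightarrow> braid_equiv n v u"
| trans: "braid_equiv n u v \<Longrightarrow> braid_equiv n v w \<Longrightarrow> braid_equiv n u w"
| cong: "braid_equiv n u v \<Longrightarrow> x \<in> braid_words n \<Longrightarrow> y \<in> braid_words n
    \<Longrightarrow> braid_equiv n (x @ u @ y) (x @ v @ y)"
| cancel: "Suc i < n \<Longrightarrow> braid_equiv n [(i, s), (i, \<not> s)] []"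
| far: "Suc i < j \<Longrightarrow> Suc j < n
    \<Longrightarrow> braid_equiv n [(i, True), (j, True)] [(j, True), (i, True)]"
| braid: "Suc (Suc i) < n
    \<Longrightarrow> braid_equiv n [(i, True), (Suc i, True), (i, True)]
                      [(Suc i, True), (i, True), (Suc i, True)]"

definition braid_rel :: "nat \<Rightarrow> braid_word rel" where
  "braid_rel n = {(u, v). braid_equiv n u v}"

definition braid_group :: "nat \<Rightarrow> braid_word set monoid" where
  "braid_group n =
     \<lparr>carrier = braid_words n // braid_rel n,
      mult = (\<lambda>X Y. \<Union>u \<in> X. \<Union>v \<in> Y. braid_rel n `` {u @ v}),
      one = braid_rel n `` {[]}\<rparr>"

fun hurwitz_move :: "('a, 'b) monoid_scheme \<Rightarrow> nat \<times> bool \<Rightarrow> 'a list \<Rightarrow> 'a list" where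
  "hurwitz_move G (i, True) as =
     as[i := as ! Suc i,
        Suc i := inv\<^bsub>G\<^esub> (as ! Suc i) \<otimes>\<^bsub>G\<^esub> as ! i \<otimes>\<^bsub>G\<^esub> as ! Suc i]"
| "hurwitz_move G (i, False) as =
     as[i := as ! i \<otimes>\<^bsub>G\<^esub> as ! Suc i \<otimes>\<^bsub>G\<^esub> inv\<^bsub>G\<^esub> (as ! i),
        Suc i := as ! i]"

text \<open>The action of a braid is that of any word representing it; \<open>the_elem\<close> picks the common
  value, which exists by the lemma \<open>hurwitz_group_action\<close> below.\<close>

definition hurwitz_action ::
  "('a, 'b) monoid_scheme \<Rightarrow> 'a list set \<Rightarrow> braid_word set \<Rightarrow> 'a list \<Rightarrow> 'a list" where
  "hurwitz_action G E X = the_elem ((\<lambda>w. restrict (foldr (hurwitz_move G) w) E) ` X)"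

definition hurwitz_connected :: "('a, 'b) monoid_scheme \<Rightarrow> 'a set \<Rightarrow> 'a \<Rightarrow> bool" where
  "hurwitz_connected G A c \<longleftrightarrow>
     transitive_action (braid_group (word_length G A c)) (Red G A c)
       (hurwitz_action G (Red G A c))"


section \<open>The Hurwitz action is a well-defined group action\<close>


lemma braid_equiv_words:
  "braid_equiv n u v \<Longrightarrow> u \<in> braid_words n \<and> v \<in> braid_words n"
  by (induction rule: braid_equiv.induct) (auto simp: braid_words_def)

lemma equiv_braid_rel: "equiv (braid_words n) (braid_rel n)"
proof (rule equivI)
  show "braid_rel n \<subseteq> braid_words n \<times> braid_words n"
    using braid_equiv_words by (auto simp: braid_rel_def)
  show "refl_on (braid_words n) (braid_rel n)"
    by (auto simp: refl_on_def braid_rel_def intro: braid_equiv.refl)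
  show "sym (braid_rel n)" by (auto simp: sym_def braid_rel_def intro: braid_equiv.sym)
  show "trans (braid_rel n)"
    unfolding trans_def braid_rel_def by (blast intro: braid_equiv.trans)
qed

lemma braid_words_append [simp]:
  "u @ v \<in> braid_words n \<longleftrightarrow> u \<in> braid_words n \<and> v \<in> braid_words n"
  by (auto simp: braid_words_def)

lemma braid_words_Nil [simp]: "[] \<in> braid_words n"
  by (auto simp: braid_words_def)

lemma braid_equiv_append:
  assumes "braid_equiv n u u'" "braid_equiv n v v'"
  shows "braid_equiv n (u @ v) (u' @ v')"
proof -
  have "braid_equiv n ([] @ u @ v) ([] @ u' @ v)"
    using assms braid_equiv_words by (intro braid_equiv.cong) auto
  moreover have "braid_equiv n (u' @ v @ []) (u' @ v' @ [])"
    using assms braid_equiv_words by (intro braid_equiv.cong) auto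
  ultimately show ?thesis using braid_equiv.trans[of n "u @ v" "u' @ v" "u' @ v'"] by simp
qed

abbreviation braid_class where "braid_class n w \<equiv> braid_rel n `` {w}"

lemma braid_class_eq: "braid_equiv n u v \<Longrightarrow> braid_class n u = braid_class n v"
  using equiv_class_eq[OF equiv_braid_rel] by (simp add: braid_rel_def)

lemma UN_const2:
  assumes "\<And>x y. x \<in> X \<Longrightarrow> y \<in> Y \<Longrightarrow> f x y = C" "x \<in> X" "y \<in> Y"
  shows "(\<Union>x \<in> X. \<Union>y \<in> Y. f x y) = C"
  using assms by fast

lemma braid_class_mult:
  assumes "u \<in> braid_words n" "v \<in> braid_words n"
  shows "braid_class n u \<otimes>\<^bsub>braid_group n\<^esub> braid_class n v = braid_class n (u @ v)"
proof -
  have "braid_class n (u' @ v') = braid_class n (u @ v)" if "u' \<in> braid_class n u" "v' \<in> braid_class n v" for u' v'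
    using that braid_equiv_append[of n u u' v v'] braid_class_eq by (auto simp: braid_rel_def)
  moreover have "u \<in> braid_class n u" "v \<in> braid_class n v"
    using assms by (auto simp: braid_rel_def intro: braid_equiv.refl)
  ultimately have "(\<Union>u' \<in> braid_class n u. \<Union>v' \<in> braid_class n v. braid_class n (u' @ v')) = braid_class n (u @ v)"
    by (intro UN_const2)
  then show ?thesis by (simp add: braid_group_def)
qed

lemma braid_class_carrier: "carrier (braid_group n) = braid_class n ` braid_words n"
  by (auto simp: braid_group_def quotient_def)

lemma word_inverse:
  "w \<in> braid_words n \<Longrightarrow> \<exists>v \<in> braid_words n. braid_equiv n (v @ w) []"
proof (induction w)
  case Nil
  have "braid_equiv n ([] @ []) []" by (simp add: braid_equiv.refl)
  then show ?case by (rule bexI) simp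
next
  case (Cons p w)
  obtain i s where p: "p = (i, s)" by force
  have i: "Suc i < n" and w: "w \<in> braid_words n" using Cons.prems p by (auto simp: braid_words_def)
  obtain v where v: "v \<in> braid_words n" "braid_equiv n (v @ w) []" using Cons.IH w by blast
  have "braid_equiv n (v @ [(i, \<not> s), (i, s)] @ w) (v @ [] @ w)"
    using braid_equiv.cancel[OF i, of "\<not> s"] v w by (intro braid_equiv.cong) auto
  then have "braid_equiv n ((v @ [(i, \<not> s)]) @ p # w) []"
    using v(2) p by (simp add: braid_equiv.trans[of n _ "v @ w"])
  moreover have "v @ [(i, \<not> s)] \<in> braid_words n" using v i by (auto simp: braid_words_def)
  ultimately show ?case by blast
qed

lemma group_braid_group: "group (braid_group n)"
proof (rule groupI)
  have one: "\<one>\<^bsub>braid_group n\<^esub> = braid_class n []" by (simp add: braid_group_def)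
  show "\<one>\<^bsub>braid_group n\<^esub> \<in> carrier (braid_group n)" by (auto simp: braid_class_carrier one)
  fix x y z assume "x \<in> carrier (braid_group n)" 
  then obtain u where u: "u \<in> braid_words n" "x = braid_class n u" by (auto simp: braid_class_carrier)
  show "\<one>\<^bsub>braid_group n\<^esub> \<otimes>\<^bsub>braid_group n\<^esub> x = x" using u by (simp add: one braid_class_mult)
  obtain v where "v \<in> braid_words n" "braid_equiv n (v @ u) []" using word_inverse u by blast
  then show "\<exists>y\<in>carrier (braid_group n). y \<otimes>\<^bsub>braid_group n\<^esub> x = \<one>\<^bsub>braid_group n\<^esub>"
    using u braid_class_eq by (auto simp: braid_class_carrier one braid_class_mult intro!: bexI[of _ v])
  assume "y \<in> carrier (braid_group n)" 
  then obtain v where v: "v \<in> braid_words n" "y = braid_class n v" by (auto simp: braid_class_carrier)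
  show "x \<otimes>\<^bsub>braid_group n\<^esub> y \<in> carrier (braid_group n)"
    using u v by (auto simp: braid_class_carrier braid_class_mult)
  assume "z \<in> carrier (braid_group n)" 
  then obtain w where w: "w \<in> braid_words n" "z = braid_class n w" by (auto simp: braid_class_carrier)
  show "x \<otimes>\<^bsub>braid_group n\<^esub> y \<otimes>\<^bsub>braid_group n\<^esub> z = x \<otimes>\<^bsub>braid_group n\<^esub> (y \<otimes>\<^bsub>braid_group n\<^esub> z)"
    using u v w by (auto simp: braid_class_mult)
qed

lemma word_prod_Cons [simp]: "word_prod G (a # as) = a \<otimes>\<^bsub>G\<^esub> word_prod G as"
  and word_prod_Nil [simp]: "word_prod G [] = \<one>\<^bsub>G\<^esub>"
  by (simp_all add: word_prod_def)

lemma (in group) word_prod_closed [simp]: "set as \<subseteq> carrier G \<Longrightarrow> word_prod G as \<in> carrier G"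
  by (induction as) auto

lemma (in group) word_prod_append [simp]:
  "set as \<subseteq> carrier G \<Longrightarrow> set bs \<subseteq> carrier G \<Longrightarrow>
   word_prod G (as @ bs) = word_prod G as \<otimes> word_prod G bs"
  by (induction as) (auto simp: m_assoc)

lemma split_at2:
  assumes "Suc i < length as"
  obtains xs a b ys where "as = xs @ a # b # ys" "length xs = i"
  using that[of "take i as" "as ! i" "as ! Suc i" "drop (Suc (Suc i)) as"] assms
  by (simp add: id_take_nth_drop Cons_nth_drop_Suc)

lemma move_split:
  "hurwitz_move G (length xs, True) (xs @ a # b # ys) =
     xs @ b # (inv\<^bsub>G\<^esub> b \<otimes>\<^bsub>G\<^esub> a \<otimes>\<^bsub>G\<^esub> b) # ys"
  "hurwitz_move G (length xs, False) (xs @ a # b # ys) =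
     xs @ (a \<otimes>\<^bsub>G\<^esub> b \<otimes>\<^bsub>G\<^esub> inv\<^bsub>G\<^esub> a) # a # ys"
  by (auto simp: nth_append list_update_append)

context group begin

lemma inv_cancel [simp]:
  assumes "a \<in> carrier G" "b \<in> carrier G"
  shows "inv a \<otimes> (a \<otimes> b) = b" "a \<otimes> (inv a \<otimes> b) = b"
  using assms by (simp_all add: m_assoc[symmetric])

lemma move_Red:
  assumes A: "A \<subseteq> carrier G" and conj: "\<forall>a\<in>A. \<forall>g\<in>carrier G. g \<otimes> a \<otimes> inv g \<in> A"
    and as: "as \<in> Red G A c" and i: "Suc i < length as"
  shows "hurwitz_move G (i, s) as \<in> Red G A c"
proof -
  obtain xs a b ys where e: "as = xs @ a # b # ys" "length xs = i" using split_at2 i by blast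
  then have m: "a \<in> A" "b \<in> A" "set xs \<subseteq> A" "set ys \<subseteq> A" using as by (auto simp: Red_def)
  then have m': "a \<in> carrier G" "b \<in> carrier G" "set xs \<subseteq> carrier G" "set ys \<subseteq> carrier G"
    using A by auto
  have "inv b \<otimes> a \<otimes> b \<in> A" using conj[rule_format, of a "inv b"] m m' by simp
  moreover have "a \<otimes> b \<otimes> inv a \<in> A" using conj m m' by simp
  ultimately show ?thesis using as m m' unfolding e(2)[symmetric] e(1)
    by (cases s) (auto simp del: hurwitz_move.simps simp: move_split Red_def m_assoc)
qed

lemma move_cancel:
  assumes "set as \<subseteq> carrier G" and i: "Suc i < length as"
  shows "hurwitz_move G (i, s) (hurwitz_move G (i, \<not> s) as) = as"
proof -
  obtain xs a b ys where e: "as = xs @ a # b # ys" "length xs = i" using split_at2 i by blast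
  then show ?thesis using assms unfolding e(2)[symmetric] e(1)
    by (cases s) (auto simp del: hurwitz_move.simps simp: move_split m_assoc inv_mult_group)
qed

lemma move_far:
  assumes "Suc i < j" "Suc j < length as"
  shows "hurwitz_move G (i, True) (hurwitz_move G (j, True) as) =
         hurwitz_move G (j, True) (hurwitz_move G (i, True) as)"
  using assms by (auto simp: list_eq_iff_nth_eq nth_list_update)

lemma move_braid:
  assumes "set as \<subseteq> carrier G" "Suc (Suc i) < length as"
  shows "hurwitz_move G (i, True) (hurwitz_move G (Suc i, True) (hurwitz_move G (i, True) as)) =
         hurwitz_move G (Suc i, True) (hurwitz_move G (i, True) (hurwitz_move G (Suc i, True) as))"
proof -
  obtain xs a b zs where e: "as = xs @ a # b # zs" "length xs = i"
    using split_at2[of i as] assms(2) Suc_lessD by blast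
  then obtain d ys where z: "zs = d # ys" using assms(2) by (cases zs) auto
  have m: "a \<in> carrier G" "b \<in> carrier G" "d \<in> carrier G" using assms e z by auto
  have S: "hurwitz_move G (Suc (length xs), True) (xs @ p # q # r # ys) =
      xs @ p # r # (inv r \<otimes> q \<otimes> r) # ys" for p q r
    using move_split(1)[of G "xs @ [p]" q r ys] by (simp del: hurwitz_move.simps)
  show ?thesis unfolding e(2)[symmetric] e(1) z
    using m by (simp del: hurwitz_move.simps add: move_split S m_assoc inv_mult_group)
qed

lemma word_Red:
  assumes A: "A \<subseteq> carrier G" and conj: "\<forall>a\<in>A. \<forall>g\<in>carrier G. g \<otimes> a \<otimes> inv g \<in> A"
    and as: "as \<in> Red G A c" and w: "w \<in> braid_words (word_length G A c)"
  shows "foldr (hurwitz_move G) w as \<in> Red G A c"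
  using w
proof (induction w)
  case (Cons p w)
  obtain i s where p: "p = (i, s)" by force
  have "foldr (hurwitz_move G) w as \<in> Red G A c" using Cons by (auto simp: braid_words_def)
  moreover have "Suc i < word_length G A c" using Cons p by (auto simp: braid_words_def)
  ultimately show ?case using move_Red[OF A conj] p by (simp add: Red_def)
qed (use as in simp)

lemma equiv_act:
  assumes A: "A \<subseteq> carrier G" and conj: "\<forall>a\<in>A. \<forall>g\<in>carrier G. g \<otimes> a \<otimes> inv g \<in> A"
    and e: "braid_equiv (word_length G A c) u v" and as: "as \<in> Red G A c"
  shows "foldr (hurwitz_move G) u as = foldr (hurwitz_move G) v as"
  using e as
proof (induction arbitrary: as rule: braid_equiv.induct)
  case (cong u v x y)
  then show ?case using word_Red[OF A conj] by simp
next
  case (cancel i s)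
  then show ?case using A move_cancel by (auto simp del: hurwitz_move.simps simp: Red_def)
next
  case (far i j)
  then have "Suc i < j" "Suc j < length as" by (auto simp: Red_def)
  from move_far[OF this] show ?case by (simp del: hurwitz_move.simps)
next
  case (braid i)
  then have "set as \<subseteq> carrier G" "Suc (Suc i) < length as" using A by (auto simp: Red_def)
  from move_braid[OF this] show ?case by (simp del: hurwitz_move.simps)
qed auto

lemma hurwitz_action_word:
  assumes A: "A \<subseteq> carrier G" and conj: "\<forall>a\<in>A. \<forall>g\<in>carrier G. g \<otimes> a \<otimes> inv g \<in> A"
    and w: "w \<in> braid_words (word_length G A c)"
  shows "hurwitz_action G (Red G A c) (braid_class (word_length G A c) w) =
         restrict (foldr (hurwitz_move G) w) (Red G A c)"
proof -
  have "restrict (foldr (hurwitz_move G) v) (Red G A c) =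
        restrict (foldr (hurwitz_move G) w) (Red G A c)"
    if "v \<in> braid_class (word_length G A c) w" for v
    using equiv_act[OF A conj, of c w v] that
    by (auto simp: braid_rel_def restrict_def fun_eq_iff)
  moreover have "w \<in> braid_class (word_length G A c) w"
    using w by (auto simp: braid_rel_def intro: braid_equiv.refl)
  ultimately have "(\<lambda>w. restrict (foldr (hurwitz_move G) w) (Red G A c)) ` braid_class (word_length G A c) w
      = {restrict (foldr (hurwitz_move G) w) (Red G A c)}" by blast
  then show ?thesis by (simp add: hurwitz_action_def)
qed

lemma word_Bij:
  assumes A: "A \<subseteq> carrier G" and conj: "\<forall>a\<in>A. \<forall>g\<in>carrier G. g \<otimes> a \<otimes> inv g \<in> A"
    and w: "w \<in> braid_words (word_length G A c)"
  shows "restrict (foldr (hurwitz_move G) w) (Red G A c) \<in> Bij (Red G A c)"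
proof -
  let ?n = "word_length G A c"
  obtain v where v: "v \<in> braid_words ?n" "braid_equiv ?n (v @ w) []" using word_inverse w by blast
  obtain u where u: "u \<in> braid_words ?n" "braid_equiv ?n (u @ v) []" using word_inverse v by blast
  have 1: "foldr (hurwitz_move G) v (foldr (hurwitz_move G) w as) = as" if "as \<in> Red G A c" for as
    using equiv_act[OF A conj v(2) that] by simp
  have 2: "foldr (hurwitz_move G) u (foldr (hurwitz_move G) v as) = as" if "as \<in> Red G A c" for as
    using equiv_act[OF A conj u(2) that] by simp
  have 3: "foldr (hurwitz_move G) w (foldr (hurwitz_move G) v as) = as" if "as \<in> Red G A c" for as
    using 1 2 word_Red[OF A conj] v(1) w that by metis
  have "bij_betw (foldr (hurwitz_move G) w) (Red G A c) (Red G A c)"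
    by (rule bij_betw_byWitness[where f' = "foldr (hurwitz_move G) v"])
       (use 1 3 word_Red[OF A conj] v(1) w in auto)
  then show ?thesis by (simp add: Bij_def)
qed

theorem hurwitz_group_action:
  assumes A: "A \<subseteq> carrier G" and conj: "\<forall>a\<in>A. \<forall>g\<in>carrier G. g \<otimes> a \<otimes> inv g \<in> A"
  shows "group_action (braid_group (word_length G A c)) (Red G A c) (hurwitz_action G (Red G A c))"
proof -
  let ?n = "word_length G A c" and ?E = "Red G A c"
  have "hurwitz_action G ?E \<in> hom (braid_group ?n) (BijGroup ?E)"
  proof (rule homI)
    fix x y assume "x \<in> carrier (braid_group ?n)" "y \<in> carrier (braid_group ?n)"
    then obtain u v where uv: "u \<in> braid_words ?n" "x = braid_class ?n u" "v \<in> braid_words ?n" "y = braid_class ?n v"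
      by (auto simp: braid_class_carrier)
    show "hurwitz_action G ?E x \<in> carrier (BijGroup ?E)"
      using uv word_Bij[OF A conj] by (simp add: hurwitz_action_word[OF A conj] BijGroup_def)
    show "hurwitz_action G ?E (x \<otimes>\<^bsub>braid_group ?n\<^esub> y) =
          hurwitz_action G ?E x \<otimes>\<^bsub>BijGroup ?E\<^esub> hurwitz_action G ?E y"
      using uv word_Bij[OF A conj] word_Red[OF A conj]
      by (auto simp: hurwitz_action_word[OF A conj] BijGroup_def braid_class_mult compose_def restrict_def fun_eq_iff)
  qed
  then show ?thesis
    by (simp add: group_action_def group_hom_def group_hom_axioms_def group_braid_group group_BijGroup)
qed

end

end

theory Submission
  imports Defs
begin

text \<open>Call a reduced word rising if its letters increase weakly.  If \<open>a\<^sub>i\<close> is larger than \<open>a\<^sub>i\<^sub>+\<^sub>1\<close>, the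
  Hurwitz move \<open>\<sigma>\<^sub>i\<close> decreases the word lexicographically and changes one element of its chain of
  prefixes, so every reduced word of \<open>c\<close> can be moved to a rising one.  Rising words are unique:
  the first letter \<open>a\<close> of a rising word of \<open>g\<close> is the least generator below \<open>g\<close>, for otherwise
  well-coveredness yields a prefix \<open>ab = a'b'\<close> of \<open>g\<close> with \<open>a'\<close> smaller than \<open>a\<close>; by compatibility
  \<open>ab\<close> is not rising, so \<open>b\<close> is smaller than \<open>a\<close>, hence smaller than the next letter, which by
  induction is the least generator below the rest.  This gives both kinds of connectedness.
  The lexicographic order on words is a shelling order: where two chains branch and meet again, the
  larger word has a non-minimal first letter, hence a descent strictly in between.\<close>

section \<open>Word length, reduced words and the prefix order\<close>

locale conj_generated = group G for G (structure) +
  fixes A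
  assumes gens_closed: "A \<subseteq> carrier G"
    and gens_generate: "\<Inter>{H. submonoid H G \<and> A \<subseteq> H} = carrier G"
    and gens_conj: "\<forall>a \<in> A. \<forall>g \<in> carrier G. g \<otimes> a \<otimes> inv g \<in> A"
begin

abbreviation len ("\<ell>") where "\<ell> x \<equiv> word_length G A x"
abbreviation wp where "wp w \<equiv> word_prod G w"
abbreviation below (infix "\<preceq>" 50) where "x \<preceq> y \<equiv> prefix_le G A x y"

text \<open>Unlike \<open>Red\<close>, this fixes no product in advance, so the property passes to
  the prefixes and suffixes of a word.\<close>

definition reduced where "reduced w \<longleftrightarrow> set w \<subseteq> A \<and> \<ell> (wp w) = length w"

lemma wp_closed [simp]: "set w \<subseteq> A \<Longrightarrow> wp w \<in> carrier G"
  using gens_closed by (meson subset_trans word_prod_closed)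

lemma wp_append [simp]: "set u \<subseteq> A \<Longrightarrow> set v \<subseteq> A \<Longrightarrow> wp (u @ v) = wp u \<otimes> wp v"
  using gens_closed by (meson subset_trans word_prod_append)

lemma gen_closed [simp]: "a \<in> A \<Longrightarrow> a \<in> carrier G"
  using gens_closed by blast

text \<open>The products of words over \<open>A\<close> form a submonoid containing
  \<open>A\<close>, hence by \<open>gens_generate\<close> they exhaust the group.\<close>

lemma ex_word:
  assumes "x \<in> carrier G"
  obtains w where "set w \<subseteq> A" "wp w = x"
proof -
  let ?H = "{wp w | w. set w \<subseteq> A}"
  have "submonoid ?H G"
  proof
    show "?H \<subseteq> carrier G" by auto
    show "\<one> \<in> ?H" by (auto intro!: exI[of _ "[]"])
    fix x y assume "x \<in> ?H" "y \<in> ?H"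
    then obtain u v where "set u \<subseteq> A" "x = wp u" "set v \<subseteq> A" "y = wp v" by blast
    then show "x \<otimes> y \<in> ?H" by (auto intro!: exI[of _ "u @ v"])
  qed
  moreover have "A \<subseteq> ?H"
  proof
    fix a assume "a \<in> A"
    then show "a \<in> ?H" by (auto intro!: exI[of _ "[a]"])
  qed
  ultimately have "\<Inter>{H. submonoid H G \<and> A \<subseteq> H} \<subseteq> ?H" by (intro Inter_lower) simp
  then have "x \<in> ?H" using assms unfolding gens_generate by (rule subsetD)
  then show ?thesis using that by auto
qed

lemma len_le: "set w \<subseteq> A \<Longrightarrow> \<ell> (wp w) \<le> length w"
  unfolding word_length_def by (rule Least_le) auto

text \<open>The \<open>LEAST\<close> in \<open>word_length\<close> is attained once some word
  represents \<open>x\<close>; \<open>ex_word\<close> provides one.\<close>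

lemma ex_reduced:
  assumes "x \<in> carrier G"
  obtains w where "reduced w" "wp w = x"
proof -
  obtain w where "set w \<subseteq> A" "wp w = x" using ex_word assms .
  then have "\<exists>k w. length w = k \<and> set w \<subseteq> A \<and> wp w = x" by blast
  from LeastI_ex[OF this] have "\<exists>w. length w = \<ell> x \<and> set w \<subseteq> A \<and> wp w = x"
    unfolding word_length_def .
  then show ?thesis using that unfolding reduced_def by metis
qed

lemma Red_iff: "w \<in> Red G A x \<longleftrightarrow> reduced w \<and> wp w = x"
  by (auto simp: Red_def reduced_def)

lemma reducedD: "reduced w \<Longrightarrow> set w \<subseteq> A" "reduced w \<Longrightarrow> \<ell> (wp w) = length w"
    "reduced w \<Longrightarrow> wp w \<in> carrier G"
  by (auto simp: reduced_def)

lemma len_one [simp]: "\<ell> \<one> = 0"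
  using len_le[of "[]"] by simp

lemma len_eq_0_iff [simp]: "x \<in> carrier G \<Longrightarrow> \<ell> x = 0 \<longleftrightarrow> x = \<one>"
  by (metis ex_reduced reducedD(2) length_0_conv word_prod_Nil len_one)

lemma len_gen_le: "a \<in> A \<Longrightarrow> \<ell> a \<le> 1"
  using len_le[of "[a]"] by simp

lemma len_mult_le:
  assumes "x \<in> carrier G" "y \<in> carrier G"
  shows "\<ell> (x \<otimes> y) \<le> \<ell> x + \<ell> y"
proof -
  obtain u where "reduced u" "wp u = x" using ex_reduced assms(1) .
  moreover obtain v where "reduced v" "wp v = y" using ex_reduced assms(2) .
  ultimately show ?thesis using len_le[of "u @ v"] by (auto simp: reduced_def)
qed

lemma wp_conj:
  assumes "set w \<subseteq> A" "g \<in> carrier G"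
  shows "wp (map (\<lambda>a. g \<otimes> a \<otimes> inv g) w) = g \<otimes> wp w \<otimes> inv g"
  using assms by (induction w) (auto simp: m_assoc)

text \<open>Conjugating every letter of a word by \<open>g\<close> conjugates its product, and the
  new letters lie in \<open>A\<close> again.\<close>

lemma len_conj_le:
  assumes "x \<in> carrier G" "g \<in> carrier G"
  shows "\<ell> (g \<otimes> x \<otimes> inv g) \<le> \<ell> x"
proof -
  obtain w where "reduced w" "wp w = x" using ex_reduced assms(1) .
  moreover from this have "set (map (\<lambda>a. g \<otimes> a \<otimes> inv g) w) \<subseteq> A"
    using gens_conj assms by (auto simp: reduced_def)
  ultimately show ?thesis
    using len_le[of "map (\<lambda>a. g \<otimes> a \<otimes> inv g) w"] wp_conj[of w g] assms
    by (auto simp: reduced_def)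
qed

lemma conj_inv_gen: "a \<in> A \<Longrightarrow> g \<in> carrier G \<Longrightarrow> inv g \<otimes> a \<otimes> g \<in> A"
  using gens_conj[rule_format, of a "inv g"] by simp

text \<open>By subadditivity of the length, a shorter word for one part would shorten the
  whole.\<close>

lemma reduced_append:
  assumes "reduced (u @ v)"
  shows "reduced u" "reduced v"
proof -
  have s: "set u \<subseteq> A" "set v \<subseteq> A" using assms by (auto simp: reduced_def)
  have "length u + length v \<le> \<ell> (wp u) + \<ell> (wp v)"
    using assms s len_mult_le[of "wp u" "wp v"] by (simp add: reduced_def)
  then show "reduced u" "reduced v" using len_le[of u] len_le[of v] s by (auto simp: reduced_def)
qed

lemma belowD: "x \<preceq> y \<Longrightarrow> x \<in> carrier G" "x \<preceq> y \<Longrightarrow> y \<in> carrier G"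
    "x \<preceq> y \<Longrightarrow> \<ell> x + \<ell> (inv x \<otimes> y) = \<ell> y"
  by (auto simp: prefix_le_def)

lemma below_refl [simp]: "x \<in> carrier G \<Longrightarrow> x \<preceq> x"
  by (simp add: prefix_le_def)

lemma one_below [simp]: "x \<in> carrier G \<Longrightarrow> \<one> \<preceq> x"
  by (simp add: prefix_le_def)

text \<open>The triangle inequality bounds the length of \<open>inv x \<otimes> z\<close> from above
  by passing through \<open>y\<close>, and from below by \<open>\<ell> z - \<ell> x\<close>; the two
  bounds coincide.\<close>

lemma below_trans:
  assumes "x \<preceq> y" "y \<preceq> z"
  shows "x \<preceq> z"
proof -
  note c = belowD[OF assms(1)] belowD[OF assms(2)]
  have "inv x \<otimes> z = (inv x \<otimes> y) \<otimes> (inv y \<otimes> z)" using c by (simp add: m_assoc)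
  then have "\<ell> (inv x \<otimes> z) \<le> \<ell> (inv x \<otimes> y) + \<ell> (inv y \<otimes> z)"
    using len_mult_le[of "inv x \<otimes> y" "inv y \<otimes> z"] c by simp
  moreover have "\<ell> z \<le> \<ell> x + \<ell> (inv x \<otimes> z)"
    using len_mult_le[of x "inv x \<otimes> z"] c by simp
  ultimately show ?thesis using c by (simp add: prefix_le_def)
qed

text \<open>The quotient has length zero, hence is trivial. Chains are compared rank by rank through
  this fact.\<close>

lemma below_len_eq:
  assumes "x \<preceq> y" "\<ell> y \<le> \<ell> x"
  shows "x = y"
proof -
  note c = belowD[OF assms(1)]
  have "\<ell> (inv x \<otimes> y) = 0" using c(3) assms(2) by linarith
  then have "inv x \<otimes> y = \<one>" using len_eq_0_iff[of "inv x \<otimes> y"] c(1,2) by blast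
  then show ?thesis using inv_cancel(2)[OF c(1,2)] r_one[OF c(1)] by metis
qed

lemma below_len: "x \<preceq> y \<Longrightarrow> \<ell> x \<le> \<ell> y"
  using belowD(3) by fastforce

lemma below_antisym: "x \<preceq> y \<Longrightarrow> y \<preceq> x \<Longrightarrow> x = y"
  using below_len below_len_eq by blast

lemma below_append:
  assumes "reduced (u @ v)"
  shows "wp u \<preceq> wp (u @ v)"
proof -
  note r = reducedD[OF assms] reducedD[OF reduced_append(1)[OF assms]]
    reducedD[OF reduced_append(2)[OF assms]]
  have "inv (wp u) \<otimes> wp (u @ v) = wp v" using r by simp
  then show ?thesis using r by (simp add: prefix_le_def)
qed

text \<open>Closure under conjugation turns suffixes into prefixes: uv is v times the conjugate of u
  by v, and that conjugate is no longer than u.\<close>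

lemma suffix_below_append:
  assumes "reduced (u @ v)"
  shows "wp v \<preceq> wp (u @ v)"
proof -
  note r = reducedD[OF assms] reducedD[OF reduced_append(1)[OF assms]]
    reducedD[OF reduced_append(2)[OF assms]]
  let ?z = "inv (wp v) \<otimes> wp u \<otimes> wp v"
  have c: "wp u \<in> carrier G" "wp v \<in> carrier G" and uv: "wp (u @ v) = wp u \<otimes> wp v"
    using r by auto
  have z: "inv (wp v) \<otimes> wp (u @ v) = ?z" "wp v \<otimes> ?z = wp (u @ v)" "?z \<in> carrier G"
    using c unfolding uv by (simp_all add: m_assoc)
  have "\<ell> ?z \<le> \<ell> (wp u)" using len_conj_le[of "wp u" "inv (wp v)"] c by simp
  moreover have "\<ell> (wp (u @ v)) \<le> \<ell> (wp v) + \<ell> ?z"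
    using len_mult_le[OF c(2) z(3)] unfolding z(2) .
  moreover have "\<ell> (wp (u @ v)) = \<ell> (wp u) + \<ell> (wp v)" using r by simp
  ultimately show ?thesis using r(3) c(2) unfolding prefix_le_def z(1) by linarith
qed

lemma reduced_append_below:
  assumes "x \<preceq> y" "reduced u" "wp u = x" "reduced v" "wp v = inv x \<otimes> y"
  shows "reduced (u @ v)" "wp (u @ v) = y"
proof -
  note c = belowD[OF assms(1)]
  show "wp (u @ v) = y" using assms c by (auto simp: reduced_def)
  then show "reduced (u @ v)" using assms c by (auto simp: reduced_def)
qed

lemma below_reduced_append:
  assumes "x \<preceq> y" "reduced u" "wp u = x"
  obtains v where "reduced (u @ v)" "wp (u @ v) = y"
proof -
  obtain v where "reduced v" "wp v = inv x \<otimes> y"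
    using ex_reduced[of "inv x \<otimes> y"] belowD[OF assms(1)] by auto
  then show ?thesis using that reduced_append_below assms by blast
qed

text \<open>Prefixes of reduced words are reduced, so the index of a prefix is the length of its
  product.\<close>

lemma wp_take_eq_iff:
  assumes "reduced u" "reduced v" "i \<le> length u" "j \<le> length v" "wp (take i u) = wp (take j v)"
  shows "i = j"
proof -
  have r: "reduced (take i u)" "reduced (take j v)"
    using assms reduced_append by (metis append_take_drop_id)+
  have "\<ell> (wp (take i u)) = i" using reducedD(2)[OF r(1)] assms(3) by simp
  moreover have "\<ell> (wp (take j v)) = j" using reducedD(2)[OF r(2)] assms(4) by simp
  ultimately show ?thesis using assms(5) by simp
qed

lemma gen_reduced: "reduced w \<Longrightarrow> a \<in> set w \<Longrightarrow> reduced [a]"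
  using reduced_append by (metis split_list append_Cons append_Nil)

text \<open>Some reduced word of \<open>h\<close> begins with \<open>a\<close>. Its first two
  letters already lead strictly above \<open>a\<close>, so in a cover they reach
  \<open>h\<close>.\<close>

lemma cover_gen:
  assumes "prefix_cover G A a h" "reduced [a]"
  obtains b where "reduced [a, b]" "wp [a, b] = h"
proof -
  have a: "a \<preceq> h" "a \<noteq> h" "\<And>z. a \<preceq> z \<Longrightarrow> z \<preceq> h \<Longrightarrow> z = a \<or> z = h" "a \<in> carrier G"
    using assms(1) by (auto simp: prefix_cover_def prefix_le_def)
  obtain v where v: "reduced ([a] @ v)" "wp ([a] @ v) = h"
    using below_reduced_append[OF a(1) assms(2)] a by auto
  obtain b v' where b: "v = b # v'" using v a by (cases v) auto
  have r: "reduced ([a, b] @ v')" using v b by simp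
  have r': "reduced ([a] @ [b])" using reduced_append(1)[OF r] by simp
  have "wp [a, b] \<preceq> h" using below_append[OF r] v b by simp
  moreover have "a \<preceq> wp [a, b]" using below_append[OF r'] a by simp
  moreover have "wp [a, b] \<noteq> a" using reducedD(2)[OF assms(2)] reducedD(2)[OF r'] a by auto
  ultimately have "wp [a, b] = h" using a by blast
  then show ?thesis using that r' by simp
qed

section \<open>Hurwitz moves and the chains traced out by words\<close>

lemma reduced_move:
  assumes "reduced (xs @ a # b # ys)"
  shows "reduced (xs @ b # (inv b \<otimes> a \<otimes> b) # ys)"
    "wp (xs @ b # (inv b \<otimes> a \<otimes> b) # ys) = wp (xs @ a # b # ys)"
proof -
  have s: "set xs \<subseteq> A" "a \<in> A" "b \<in> A" "set ys \<subseteq> A" using assms by (auto simp: reduced_def)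
  have m: "inv b \<otimes> a \<otimes> b \<in> A" using conj_inv_gen s by simp
  show eq: "wp (xs @ b # (inv b \<otimes> a \<otimes> b) # ys) = wp (xs @ a # b # ys)"
    using s m by (simp add: m_assoc)
  show "reduced (xs @ b # (inv b \<otimes> a \<otimes> b) # ys)"
    using assms s m eq unfolding reduced_def by simp
qed

text \<open>The chain that a word traces out; for a reduced word it has exactly one element of each
  length up to \<open>length w\<close>.\<close>

definition flag where "flag w = (\<lambda>k. wp (take k w)) ` {..length w}"

lemma flagI: "k \<le> length w \<Longrightarrow> wp (take k w) \<in> flag w"
  by (simp add: flag_def)

lemma flagE:
  assumes "x \<in> flag w"
  obtains k where "k \<le> length w" "x = wp (take k w)"
  using assms by (auto simp: flag_def)

lemma card_flag:
  assumes "reduced w"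
  shows "card (flag w) = Suc (length w)"
proof -
  have "inj_on (\<lambda>k. wp (take k w)) {..length w}"
    using wp_take_eq_iff[OF assms assms] by (auto simp: inj_on_def)
  then show ?thesis unfolding flag_def by (simp add: card_image)
qed

lemma flag_take_eq:
  assumes "reduced u" "reduced v" "flag u \<subseteq> flag v" "k \<le> length u"
  shows "wp (take k u) = wp (take k v)"
proof -
  have "wp (take k u) \<in> flag v" using flagI assms by blast
  then obtain j where j: "j \<le> length v" "wp (take k u) = wp (take j v)" by (rule flagE)
  then have "k = j" using wp_take_eq_iff assms by blast
  then show ?thesis using j by simp
qed

text \<open>Each letter is recovered by cancellation from the prefix products just before and just
  after it.\<close>

lemma take_wp_inj:
  assumes "set u \<subseteq> A" "set v \<subseteq> A" "length u = length v"
    and "\<And>k. k \<le> length u \<Longrightarrow> wp (take k u) = wp (take k v)"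
  shows "u = v"
proof (rule nth_equalityI)
  fix i assume i: "i < length u"
  have u: "set (take i u) \<subseteq> A" "u ! i \<in> A" and v: "set (take i v) \<subseteq> A" "v ! i \<in> A"
    using assms(1-3) i by (auto dest: in_set_takeD)
  have "wp (take i u) \<otimes> u ! i = wp (take i v) \<otimes> v ! i"
    using assms(4)[of "Suc i"] i u v assms(3) by (simp add: take_Suc_conv_app_nth)
  then show "u ! i = v ! i" using assms(4)[of i] i u v by simp
qed (rule assms)

lemma flag_inj:
  assumes "reduced u" "reduced v" "length u = length v" "flag u = flag v"
  shows "u = v"
  using take_wp_inj[of u v] flag_take_eq[of u v] assms by (simp add: reduced_def)

text \<open>Both words pass through the same products except at the position between the two
  exchanged letters.\<close>

lemma flag_diff:
  assumes "reduced (xs @ a # b # ys)" "reduced (xs @ a' # b' # ys)"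
    and "a \<otimes> b = a' \<otimes> b'" "a \<noteq> a'"
  shows "flag (xs @ a # b # ys) - flag (xs @ a' # b' # ys) = {wp (xs @ [a])}"
proof -
  let ?v = "xs @ a # b # ys" and ?v' = "xs @ a' # b' # ys" and ?n = "Suc (length xs)"
  have s: "set xs \<subseteq> A" "a \<in> A" "b \<in> A" "a' \<in> A" "b' \<in> A" "set ys \<subseteq> A"
    using reducedD(1)[OF assms(1)] reducedD(1)[OF assms(2)] by simp_all
  have eq: "wp (take k ?v) = wp (take k ?v')" if "k \<noteq> ?n" for k
  proof (cases "k \<le> length xs")
    case False
    \<comment> \<open>Here the prefix contains both exchanged letters, whose product is the same in
      the two words; \<open>m\<close> counts the letters taken from \<open>ys\<close>.\<close>
    define m where "m = k - (length xs + 2)"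
    have k: "k = length xs + 2 + m" using that False unfolding m_def by linarith
    have "set (take m ys) \<subseteq> A" using s set_take_subset by fast
    then have "wp (take m ys) \<in> carrier G" by simp
    then have "a \<otimes> (b \<otimes> wp (take m ys)) = a' \<otimes> (b' \<otimes> wp (take m ys))"
      using s assms(3) by (simp add: m_assoc[symmetric])
    then show ?thesis using k s \<open>set (take m ys) \<subseteq> A\<close> by simp
  qed simp
  \<comment> \<open>It could only occur at the same index, where cancelling \<open>xs\<close> would
    give \<open>a = a'\<close>.\<close>
  have notin: "wp (xs @ [a]) \<notin> flag ?v'"
  proof
    assume "wp (xs @ [a]) \<in> flag ?v'"
    then obtain j where j: "j \<le> length ?v'" "wp (take ?n ?v) = wp (take j ?v')"
      by (auto elim: flagE)
    then have "?n = j" using wp_take_eq_iff[OF assms(1,2)] by simp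
    from j(2)[folded this] have "wp xs \<otimes> a = wp xs \<otimes> a'" using s by simp
    then show False using s assms(4) by simp
  qed
  have "x \<in> flag ?v'" if x: "x \<in> flag ?v" "x \<noteq> wp (xs @ [a])" for x
  proof -
    obtain k where k: "k \<le> length ?v" "x = wp (take k ?v)" using x(1) by (rule flagE)
    then have "k \<noteq> ?n" using x(2) by auto
    then show ?thesis using k eq flagI[of k ?v'] by simp
  qed
  moreover have "wp (xs @ [a]) \<in> flag ?v" using flagI[of ?n ?v] by simp
  ultimately show ?thesis using notin by blast
qed

section \<open>Maximal chains of the factorization poset\<close>

lemma wp_take_below:
  assumes "reduced w" "i \<le> j"
  shows "wp (take i w) \<preceq> wp (take j w)"
proof -
  have e: "take j w = take i w @ drop i (take j w)"
    using assms(2) by (metis append_take_drop_id min.absorb1 take_take)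
  have "reduced (take j w)" using reduced_append(1)[of "take j w" "drop j w"] assms(1) by simp
  then show ?thesis using below_append[of "take i w" "drop i (take j w)"] e by simp
qed

lemma factor_poset_iff: "x \<in> factor_poset G A g \<longleftrightarrow> x \<preceq> g"
  using belowD by (auto simp: factor_poset_def)

lemma factor_order_iff: "(x, y) \<in> factor_order G A g \<longleftrightarrow> x \<preceq> y \<and> y \<preceq> g"
  using below_trans by (auto simp: factor_order_def factor_poset_iff)

abbreviation chains where
  "chains g \<equiv> {C. pred_on.chain (factor_poset G A g) (\<lambda>x y. (x, y) \<in> factor_order G A g) C}"

text \<open>\<open>pred_on.chain\<close> compares elements by the reflexive closure of the relation,
  which for this reflexive order is the order itself.\<close>

lemma chains_iff:
  "C \<in> chains g \<longleftrightarrow> (\<forall>x\<in>C. x \<preceq> g) \<and> (\<forall>x\<in>C. \<forall>y\<in>C. x \<preceq> y \<or> y \<preceq> x)"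
proof -
  have "x \<preceq> x" if "x \<preceq> g" for x using belowD(1)[OF that] by simp
  then show ?thesis
    unfolding pred_on.chain_def mem_Collect_eq factor_poset_iff factor_order_iff subset_eq sup_apply sup_bool_def
    by blast
qed

lemma max_chains_iff:
  "M \<in> max_chains (factor_poset G A g) (factor_order G A g) \<longleftrightarrow>
     M \<in> chains g \<and> (\<forall>C \<in> chains g. M \<subseteq> C \<longrightarrow> C = M)"
  by (auto simp: max_chains_def pred_on.maxchain_def)

lemma flag_chain:
  assumes "reduced w"
  shows "flag w \<in> chains (wp w)"
  unfolding chains_iff
proof (intro conjI ballI)
  fix x assume "x \<in> flag w"
  then show "x \<preceq> wp w" using wp_take_below[OF assms, of _ "length w"] by (auto elim!: flagE)
  fix y assume "y \<in> flag w"
  then obtain i j where "x = wp (take i w)" "y = wp (take j w)"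
    using \<open>x \<in> flag w\<close> by (metis flagE)
  then show "x \<preceq> y \<or> y \<preceq> x"
    using wp_take_below[OF assms, of i j] wp_take_below[OF assms, of j i] linear[of i j] by metis
qed

text \<open>An element \<open>x\<close> of a larger chain is comparable with the prefix of
  \<open>w\<close> that has the same length as \<open>x\<close>, hence equal to it.\<close>

lemma flag_maximal:
  assumes "reduced w" "C \<in> chains (wp w)" "flag w \<subseteq> C"
  shows "C = flag w"
proof -
  have "x \<in> flag w" if x: "x \<in> C" for x
  proof -
    have xw: "x \<preceq> wp w" using assms(2) x unfolding chains_iff by blast
    let ?k = "\<ell> x"
    let ?y = "wp (take ?k w)"
    have k: "?k \<le> length w" using below_len[OF xw] reducedD(2)[OF assms(1)] by simp
    have "reduced (take ?k w)" using reduced_append(1)[of "take ?k w" "drop ?k w"] assms(1) by simp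
    then have ly: "\<ell> ?y = ?k" using reducedD(2) k by fastforce
    have y: "?y \<in> flag w" using k by (rule flagI)
    then have "x \<preceq> ?y \<or> ?y \<preceq> x" using assms(2,3) x unfolding chains_iff by blast
    then have "x = ?y" using below_len_eq ly by (metis order_refl)
    then show ?thesis using y by simp
  qed
  then show ?thesis using assms(3) by blast
qed

text \<open>Induction from the top: a reduced word for the greatest element \<open>m\<close> that
  passes through the rest of the chain is prolonged to a word for \<open>g\<close>.\<close>

lemma chain_subset_flag:
  assumes "finite C" "C \<in> chains g" "g \<in> carrier G"
  shows "\<exists>w. reduced w \<and> wp w = g \<and> C \<subseteq> flag w"
  using assms
proof (induction "card C" arbitrary: C g)
  case 0
  then have "C = {}" by simp
  then show ?case using ex_reduced[OF 0(4)] by auto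
next
  case (Suc n)
  have ne: "C \<noteq> {}" using Suc.hyps(2) by auto
  \<comment> \<open>Comparable elements are ordered by length, so an element of maximal length is
    the greatest of the chain.\<close>
  have "Max (\<ell> ` C) \<in> \<ell> ` C" using Suc.prems(1) ne by (intro Max_in) simp_all
  then obtain m where m: "m \<in> C" "\<ell> m = Max (\<ell> ` C)" by (metis imageE)
  have max: "\<ell> x \<le> \<ell> m" if "x \<in> C" for x
    using that Suc.prems(1) unfolding m(2) by (intro Max_ge) simp_all
  have mg: "m \<preceq> g" using Suc.prems(2) m(1) unfolding chains_iff by blast
  have "x \<preceq> m" if "x \<in> C" for x
  proof -
    have "x \<preceq> m \<or> m \<preceq> x" using Suc.prems(2) that m(1) unfolding chains_iff by blast
    then show ?thesis using below_len_eq[of m x] max[OF that] belowD(1)[OF mg] by auto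
  qed
  then have "C - {m} \<in> chains m" using Suc.prems(2) unfolding chains_iff by blast
  moreover have "n = card (C - {m})" "finite (C - {m})" using Suc m by auto
  ultimately obtain u where u: "reduced u" "wp u = m" "C - {m} \<subseteq> flag u"
    using Suc.hyps(1)[of "C - {m}" m] belowD(1)[OF mg] by blast
  obtain v where v: "reduced (u @ v)" "wp (u @ v) = g"
    using below_reduced_append[OF mg u(1,2)] .
  have "flag u \<subseteq> flag (u @ v)"
  proof
    fix x assume "x \<in> flag u"
    then obtain k where "k \<le> length u" "x = wp (take k u)" by (rule flagE)
    then show "x \<in> flag (u @ v)" using flagI[of k "u @ v"] by simp
  qed
  moreover have "m \<in> flag (u @ v)" using flagI[of "length u" "u @ v"] u by simp
  ultimately show ?case using u v by blast
qed

text \<open>A maximal chain lies in some flag and so equals it; conversely flags are maximal. This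
  replaces maximal chains by reduced words in all that follows.\<close>

lemma max_chains_eq:
  assumes "g \<in> carrier G" "finite (factor_poset G A g)"
  shows "max_chains (factor_poset G A g) (factor_order G A g) = flag ` Red G A g"
proof (intro equalityI subsetI)
  fix M assume "M \<in> max_chains (factor_poset G A g) (factor_order G A g)"
  then have M: "M \<in> chains g" "\<And>C. C \<in> chains g \<Longrightarrow> M \<subseteq> C \<Longrightarrow> C = M"
    unfolding max_chains_iff by blast+
  then have "M \<subseteq> factor_poset G A g" unfolding chains_iff by (auto simp: factor_poset_iff)
  then have "finite M" using assms(2) finite_subset by blast
  then obtain w where w: "reduced w" "wp w = g" "M \<subseteq> flag w"
    using chain_subset_flag M(1) assms(1) by blast
  then have "flag w = M" using M(2) flag_chain by blast
  then show "M \<in> flag ` Red G A g" using w by (auto simp: Red_iff)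
next
  fix M assume "M \<in> flag ` Red G A g"
  then obtain w where "reduced w" "wp w = g" "M = flag w" by (auto simp: Red_iff)
  then show "M \<in> max_chains (factor_poset G A g) (factor_order G A g)"
    unfolding max_chains_iff using flag_chain flag_maximal by blast
qed

text \<open>Every element below \<open>g\<close> is a prefix of one of the finitely many reduced
  words of \<open>g\<close>.\<close>

lemma finite_factor_poset:
  assumes "finite (Red G A g)"
  shows "finite (factor_poset G A g)"
proof -
  have "factor_poset G A g \<subseteq> (\<Union>w \<in> Red G A g. flag w)"
  proof
    fix x assume "x \<in> factor_poset G A g"
    then have xg: "x \<preceq> g" by (simp add: factor_poset_iff)
    obtain u where u: "reduced u" "wp u = x" using ex_reduced belowD(1)[OF xg] .
    obtain v where v: "reduced (u @ v)" "wp (u @ v) = g" using below_reduced_append[OF xg u] .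
    have "x \<in> flag (u @ v)" using flagI[of "length u" "u @ v"] u by simp
    then show "x \<in> (\<Union>w \<in> Red G A g. flag w)" using v by (auto simp: Red_iff)
  qed
  moreover have "finite (flag w)" for w by (simp add: flag_def)
  ultimately show ?thesis using assms finite_subset by blast
qed

lemma finite_bounded_graded_factor_poset:
  assumes "g \<in> carrier G" "finite (Red G A g)"
  shows "finite_bounded_graded (factor_poset G A g) (factor_order G A g)"
  unfolding finite_bounded_graded_def
proof (intro conjI)
  show "finite (factor_poset G A g)" using finite_factor_poset assms by blast
  show "partial_order_on (factor_poset G A g) (factor_order G A g)"
    unfolding partial_order_on_def preorder_on_def
  proof (intro conjI)
    show "factor_order G A g \<subseteq> factor_poset G A g \<times> factor_poset G A g"
      by (auto simp: factor_order_def)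
    show "refl_on (factor_poset G A g) (factor_order G A g)"
      using belowD(1) by (auto simp: refl_on_def factor_order_iff factor_poset_iff)
    show "trans (factor_order G A g)"
      using below_trans unfolding trans_def factor_order_iff by blast
    show "antisym (factor_order G A g)"
      using below_antisym unfolding antisym_def factor_order_iff by blast
  qed
  show "\<exists>b\<in>factor_poset G A g. \<forall>x\<in>factor_poset G A g. (b, x) \<in> factor_order G A g"
    using assms belowD(1) by (intro bexI[of _ \<one>]) (auto simp: factor_order_iff factor_poset_iff)
  show "\<exists>t\<in>factor_poset G A g. \<forall>x\<in>factor_poset G A g. (x, t) \<in> factor_order G A g"
    using assms by (intro bexI[of _ g]) (auto simp: factor_order_iff factor_poset_iff)
  show "\<forall>M\<in>max_chains (factor_poset G A g) (factor_order G A g).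
        \<forall>N\<in>max_chains (factor_poset G A g) (factor_order G A g). card M = card N"
    unfolding max_chains_eq[OF assms(1) finite_factor_poset[OF assms(2)]]
    using card_flag reducedD(2) by (metis (no_types, lifting) Red_iff imageE)
qed

end

section \<open>Rising words and descents\<close>

locale compatible_well_covered = conj_generated G A for G (structure) and A +
  \<comment> \<open>The order on the generators below \<open>c\<close> enters as a rank function to
    the naturals, so that \<open>sorted\<close> and \<open>lenlex less_than\<close> apply to
    \<open>map f w\<close>.\<close>
  fixes c and f :: "'a \<Rightarrow> nat"
  assumes c_closed: "c \<in> carrier G"
    and finite_Red: "finite (Red G A c)"
    and inj_f: "inj_on f (gens_below G A c)"
    \<comment> \<open>Uniqueness of rising factorizations of length two, recorded for the first
      letter; the second then follows by cancellation.\<close>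
    and compat: "\<lbrakk>reduced [a, b]; reduced [a', b']; wp [a, b] \<preceq> c; wp [a, b] = wp [a', b'];
      f a \<le> f b; f a' \<le> f b'\<rbrakk> \<Longrightarrow> a = a'"
    \<comment> \<open>The generator \<open>b\<close> witnesses that \<open>a\<close> is not least
      below \<open>g\<close>; the conclusion unfolds that the cover set of \<open>a\<close> is
      nonempty.\<close>
    and well_cov: "\<lbrakk>g \<preceq> c; a \<in> gens_below G A g; b \<in> gens_below G A g; f b < f a\<rbrakk> \<Longrightarrow>
      \<exists>a' \<in> gens_below G A g. \<exists>h. f a' < f a \<and> h \<preceq> g \<and> prefix_cover G A a h \<and> prefix_cover G A a' h"
begin

text \<open>The words to which \<open>compat\<close> and \<open>well_cov\<close> apply; their
  letters lie where \<open>f\<close> is injective.\<close>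

definition good where "good w \<longleftrightarrow> reduced w \<and> wp w \<preceq> c"

abbreviation rising where "rising w \<equiv> sorted (map f w)"
text \<open>\<open>lenlex\<close> is well-founded and total; on the reduced words of one element,
  which have equal length, it is the lexicographic order.\<close>

abbreviation lex_less where "lex_less u v \<equiv> (map f u, map f v) \<in> lenlex less_than"

text \<open>A Hurwitz generator applied where the rank drops strictly; compare
  \<open>move_split\<close>.\<close>

definition descent where
  "descent v w \<longleftrightarrow> (\<exists>xs a b ys. v = xs @ a # b # ys \<and> f b < f a \<and>
     w = xs @ b # (inv b \<otimes> a \<otimes> b) # ys)"

lemma goodD: "good w \<Longrightarrow> reduced w" "good w \<Longrightarrow> wp w \<preceq> c"
  by (auto simp: good_def)

lemma good_append:
  assumes "good (u @ v)"
  shows "good u" "good v"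
proof -
  have r: "reduced (u @ v)" and c: "wp (u @ v) \<preceq> c" using assms by (auto simp: good_def)
  show "good u" unfolding good_def
    using reduced_append(1)[OF r] below_trans[OF below_append[OF r] c] by (rule conjI)
  show "good v" unfolding good_def
    using reduced_append(2)[OF r] below_trans[OF suffix_below_append[OF r] c] by (rule conjI)
qed

lemma good_ConsD: "good (a # u) \<Longrightarrow> good u"
  using good_append(2)[of "[a]" u] by simp

text \<open>A letter is a prefix of the suffix starting with it, and that suffix lies below the
  whole product.\<close>

lemma letters_below:
  assumes "reduced w" "a \<in> set w"
  shows "a \<in> gens_below G A (wp w)"
proof -
  obtain xs ys where w: "w = xs @ a # ys" using assms(2) by (meson split_list)
  have r: "reduced ([a] @ ys)" using reduced_append(2)[of xs] assms(1) w by simp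
  have "a \<in> A" using r by (simp add: reduced_def)
  then have "a \<preceq> wp (a # ys)" using below_append[OF r] by simp
  moreover have "wp (a # ys) \<preceq> wp w" using suffix_below_append assms(1) w by blast
  ultimately show ?thesis using \<open>a \<in> A\<close> below_trans by (auto simp: gens_below_def)
qed

lemma gens_below_mono: "g \<preceq> h \<Longrightarrow> gens_below G A g \<subseteq> gens_below G A h"
  using below_trans by (auto simp: gens_below_def)

lemma good_letters: "good w \<Longrightarrow> set w \<subseteq> gens_below G A c"
  using letters_below gens_below_mono unfolding good_def by blast

lemma lex_total:
  assumes "good u" "good v" "u \<noteq> v"
  shows "lex_less u v \<or> lex_less v u"
proof -
  have "inj_on f (set u \<union> set v)"
    using inj_f good_letters assms by (meson Un_least inj_on_subset)
  then have "map f u \<noteq> map f v" using assms(3) map_inj_on by blast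
  moreover have "total (lenlex less_than)" by (intro total_lenlex) (auto simp: total_on_def)
  ultimately show ?thesis unfolding total_on_def by blast
qed

lemma lex_trans: "lex_less u v \<Longrightarrow> lex_less v w \<Longrightarrow> lex_less u w"
  by (meson lenlex_trans trans_less_than)

lemma lex_irrefl: "\<not> lex_less u u"
  by (rule lenlex_irreflexive) simp

lemma descent_lex: "descent v w \<Longrightarrow> lex_less w v"
  by (auto simp: descent_def Cons_lenlex_iff irrefl_def)

lemma descent_good:
  assumes "descent v w" "good v"
  shows "good w" "wp w = wp v"
  using assms reduced_move by (auto simp: descent_def good_def)

lemma not_rising_split:
  assumes "\<not> rising v"
  obtains xs a b ys where "v = xs @ a # b # ys" "f b < f a"
proof -
  obtain i where i: "Suc i < length v" "f (v ! Suc i) < f (v ! i)"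
    using assms by (auto simp: sorted_iff_nth_Suc not_le)
  then obtain xs a b ys where v: "v = xs @ a # b # ys" "length xs = i" using split_at2 by blast
  have "f b < f a" using i v by (auto simp: nth_append)
  then show ?thesis using that v by blast
qed

text \<open>A word that is not rising admits a descent, and descents go down in a well-founded
  order. The lexicographic bound on \<open>w\<close> serves to control its first letter in
  \<open>rising_head_min\<close>.\<close>

lemma rising_via_descents:
  assumes "good v"
  shows "\<exists>w. good w \<and> wp w = wp v \<and> rising w \<and> descent\<^sup>*\<^sup>* v w \<and> (w = v \<or> lex_less w v)"
proof -
  have "wf (inv_image (lenlex less_than) (map f))" by (simp add: wf_lenlex)
  then show ?thesis using assms
  proof (induction v rule: wf_induct_rule)
    case (less v)
    show ?case
    proof (cases "rising v")
      case False
      then obtain xs a b ys where "v = xs @ a # b # ys" "f b < f a" by (rule not_rising_split)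
      then have d: "descent v (xs @ b # (inv b \<otimes> a \<otimes> b) # ys)" (is "descent v ?v'")
        by (auto simp: descent_def)
      obtain w where w: "good w" "wp w = wp ?v'" "rising w" "descent\<^sup>*\<^sup>* ?v' w" "w = ?v' \<or> lex_less w ?v'"
        using less.IH[of ?v'] descent_lex[OF d] descent_good[OF d less.prems] by auto
      have "descent\<^sup>*\<^sup>* v w" using d w(4) by (rule converse_rtranclp_into_rtranclp)
      moreover have "lex_less w v" using w(5) descent_lex[OF d] lex_trans by blast
      ultimately show ?thesis using w descent_good[OF d less.prems] by metis
    qed (use less.prems in blast)
  qed
qed

lemma rising_head_min:
  assumes "good (a # u)" "rising (a # u)" "b \<in> gens_below G A (wp (a # u))"
  shows "f a \<le> f b"
  using assms
proof (induction u arbitrary: a b rule: length_induct)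
  case (1 u)
  show ?case
  proof (rule ccontr)
    assume "\<not> f a \<le> f b"
    then have ba: "f b < f a" by simp
    let ?g = "wp (a # u)"
    have r: "reduced (a # u)" and gc: "?g \<preceq> c" using "1.prems"(1) by (auto simp: good_def)
    have a: "a \<in> gens_below G A ?g" using letters_below[OF r] by simp
    obtain a' h where h: "a' \<in> gens_below G A ?g" "f a' < f a" "h \<preceq> ?g"
        "prefix_cover G A a h" "prefix_cover G A a' h"
      using well_cov[OF gc a "1.prems"(3) ba] by blast
    have ra: "reduced [a]" using gen_reduced[OF r] by simp
    obtain s where s: "reduced [a, s]" "wp [a, s] = h" using cover_gen[OF h(4) ra] .
    \<comment> \<open>For \<open>cover_gen\<close> the word \<open>[a']\<close> has to be reduced.
      Were \<open>a'\<close> the identity, \<open>a\<close> would lie strictly between it and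
      \<open>h\<close>.\<close>
    have "a' \<noteq> \<one>"
    proof
      assume "a' = \<one>"
      then have "a = \<one> \<or> a = h" using h(4,5) by (auto simp: prefix_cover_def prefix_le_def)
      then show False using reducedD(2)[OF ra] h(4) ra by (auto simp: prefix_cover_def reduced_def)
    qed
    moreover have "a' \<in> A" using h(1) by (simp add: gens_below_def)
    then have "\<ell> a' \<le> 1" "a' \<in> carrier G" using len_gen_le by simp_all
    ultimately have "\<ell> a' = 1" using len_eq_0_iff[of a'] le_SucE[of "\<ell> a'" 0] by auto
    then have "reduced [a']" using \<open>a' \<in> A\<close> by (simp add: reduced_def)
    then obtain s' where s': "reduced [a', s']" "wp [a', s'] = h" using cover_gen[OF h(5)] by blast
    have hc: "h \<preceq> c" using h(3) gc by (rule below_trans)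
    \<comment> \<open>Otherwise \<open>[a, s]\<close> is rising. Sorting \<open>[a', s']\<close> by
      descents gives a rising word of \<open>h\<close> whose first letter has rank at most
      \<open>f a'\<close>; by \<open>compat\<close> that letter is \<open>a\<close>, a
      contradiction.\<close>
    have sa: "f s < f a"
    proof (rule ccontr)
      assume as: "\<not> f s < f a"
      have "good [a', s']" using s' hc by (simp add: good_def)
      then obtain w where w: "good w" "wp w = wp [a', s']" "rising w" "w = [a', s'] \<or> lex_less w [a', s']"
        using rising_via_descents by blast
      have "length w = 2" using reducedD(2)[OF goodD(1)[OF w(1)]] reducedD(2)[OF s'(1)] w(2) by simp
      then obtain x y where xy: "w = [x, y]" by (auto simp: length_Suc_conv numeral_2_eq_2)
      have "f x \<le> f a'" using w(4) xy by (auto simp: Cons_lenlex_iff)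
      moreover have "a = x"
        by (rule compat[of a s x y]) (use s s' hc w as xy goodD(1)[OF w(1)] in auto)
      ultimately show False using h(2) by simp
    qed
    \<comment> \<open>Prolonging \<open>[a, s]\<close> to a word of \<open>?g\<close> and cancelling
      \<open>a\<close> shows that \<open>s\<close> starts a reduced word of
      \<open>wp u\<close>.\<close>
    obtain v where v: "reduced ([a, s] @ v)" "wp ([a, s] @ v) = ?g"
      using below_reduced_append[OF h(3) s] .
    have sv: "set (s # v) \<subseteq> A" and au: "a \<in> A" "set u \<subseteq> A"
      using reducedD(1)[OF v(1)] reducedD(1)[OF r] by simp_all
    have "a \<otimes> wp (s # v) = a \<otimes> wp u" using v(2) by simp
    then have eq: "wp (s # v) = wp u"
      using Units_l_cancel[of a "wp (s # v)" "wp u"] wp_closed[OF sv] wp_closed[OF au(2)] au(1)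
      by (simp del: word_prod_Cons)
    have "length ([a, s] @ v) = length (a # u)"
      using reducedD(2)[OF v(1)] reducedD(2)[OF r] v(2) by simp
    then obtain a2 u' where u: "u = a2 # u'" by (cases u) auto
    have "reduced (s # v)" using reduced_append(2)[of "[a]" "s # v"] v(1) by simp
    then have "s \<in> gens_below G A (wp (a2 # u'))"
      using letters_below[of "s # v" s] eq u by simp
    \<comment> \<open>The induction hypothesis for the rising tail \<open>u\<close> yields the cycle
      \<open>f a \<le> f a2 \<le> f s < f a\<close>.\<close>
    then have "f a2 \<le> f s"
      using "1.IH"[rule_format, of u' a2 s] good_ConsD[OF "1.prems"(1)] "1.prems"(2) u by simp
    then show False using sa "1.prems"(2) u by simp
  qed
qed

text \<open>By \<open>rising_head_min\<close> the first letters of both words are least below the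
  same element, so they agree and can be cancelled.\<close>

lemma rising_unique:
  assumes "good u" "good v" "rising u" "rising v" "wp u = wp v"
  shows "u = v"
  using assms
proof (induction u arbitrary: v)
  case Nil
  have "length v = 0"
    using reducedD(2)[OF goodD(1)[OF Nil.prems(2)]] Nil.prems(5)[symmetric] by simp
  then show ?case by simp
next
  case (Cons a u)
  have rs: "reduced (a # u)" "reduced v" using goodD(1) Cons.prems by blast+
  have "length v = length (a # u)"
    using reducedD(2)[OF rs(1)] reducedD(2)[OF rs(2)] Cons.prems(5) by simp
  then obtain b w where v: "v = b # w" by (cases v) auto
  have "a \<in> gens_below G A (wp (b # w))" "b \<in> gens_below G A (wp (a # u))"
    using letters_below[OF rs(1), of a] letters_below[OF rs(2), of b] Cons.prems(5) v by simp_all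
  then have "f a = f b"
    using rising_head_min[of a u b] rising_head_min[of b w a] Cons.prems(1-4) v by (auto intro: antisym)
  moreover have "a \<in> gens_below G A c" "b \<in> gens_below G A c"
    using good_letters[OF Cons.prems(1)] good_letters[OF Cons.prems(2)] v by auto
  ultimately have ab: "a = b" using inj_f by (simp add: inj_on_def)
  have "wp u \<in> carrier G" "wp w \<in> carrier G" "a \<in> carrier G"
    using rs v by (auto simp: reduced_def)
  then have "wp u = wp w" using Cons.prems(5) v ab by simp
  then have "u = w" using Cons.IH[of w] Cons.prems v good_ConsD by auto
  then show ?case using ab v by simp
qed

text \<open>The element \<open>wp (xs @ [a])\<close> is the one to be exchanged in the shelling
  condition. Common first letters are stripped by induction; the real case is a difference in the
  first letter.\<close>

lemma shelling_descent:
  assumes "good u" "good v" "wp u = wp v" "lex_less u v"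
  shows "\<exists>xs a b ys. v = xs @ a # b # ys \<and> f b < f a \<and> wp (xs @ [a]) \<notin> flag u"
  using assms
proof (induction v arbitrary: u)
  case (Cons b v)
  have rs: "reduced u" "reduced (b # v)" using goodD(1) Cons.prems by blast+
  have len: "length u = length (b # v)"
    using reducedD(2)[OF rs(1)] reducedD(2)[OF rs(2)] Cons.prems(3) by simp
  then obtain a u' where u: "u = a # u'" by (cases u) auto
  have A: "a \<in> A" "set u' \<subseteq> A" "b \<in> A" "set v \<subseteq> A" using rs u by (auto simp: reduced_def)
  consider "f a < f b" | "f a = f b" "lex_less u' v"
    using Cons.prems(4) len u by (auto simp: Cons_lenlex_iff)
  then show ?case
  proof cases
    case 1
    \<comment> \<open>The least such \<open>j\<close> is where the two chains first meet again after
      branching at the identity; they do meet, since both end in the same product.\<close>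
    let ?P = "\<lambda>j. 0 < j \<and> wp (take j u) = wp (take j (b # v))"
    define j where "j = (LEAST j. ?P j)"
    have P: "?P (length u)" using len Cons.prems(3) u by simp
    then have j: "?P j" "j \<le> length u" unfolding j_def by (rule LeastI, rule Least_le)
    have least: "\<not> ?P k" if "k < j" for k using that not_less_Least unfolding j_def by blast
    obtain i where i: "j = Suc i" using j(1) by (cases j) auto
    have "good (take j (b # v))"
      using good_append(1)[of "take j (b # v)" "drop j (b # v)"] Cons.prems(2) by simp
    then have gv: "good (b # take i v)" using i by simp
    have "reduced (take j u)" using reduced_append(1)[of "take j u" "drop j u"] rs(1) by simp
    then have "a \<in> gens_below G A (wp (b # take i v))"
      using letters_below[of "take j u" a] j(1) u i by simp
    \<comment> \<open>The first letter of \<open>u\<close> lies below the meeting point and has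
      smaller rank than \<open>b\<close>, so the segment of \<open>b # v\<close> up to there has a
      descent.\<close>
    then have "\<not> rising (b # take i v)" using rising_head_min[OF gv] 1 by fastforce
    then obtain xs x y ys where e: "b # take i v = xs @ x # y # ys" "f y < f x"
      by (rule not_rising_split)
    have ev: "b # v = xs @ x # y # (ys @ drop i v)"
      using e(1) append_take_drop_id[of i v] by (metis append_Cons append_assoc)
    have "wp (xs @ [x]) \<notin> flag u"
    proof
      assume "wp (xs @ [x]) \<in> flag u"
      then obtain k where k: "k \<le> length u" "wp (xs @ [x]) = wp (take k u)" by (rule flagE)
      have t: "take (Suc (length xs)) (b # v) = xs @ [x]" unfolding ev by simp
      have "Suc (length xs) = k"
        using wp_take_eq_iff[OF rs(2,1), of "Suc (length xs)" k] k t ev by simp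
      then have "?P k" using t k(2) by auto
      \<comment> \<open>Both letters \<open>x\<close> and \<open>y\<close> of the descent lie within
        the first \<open>j\<close> letters, so the prefix ending in \<open>x\<close> comes before
        the meeting point.\<close>
      moreover have "k < j"
      proof -
        have "length (b # take i v) = length xs + 2 + length ys" unfolding e(1) by simp
        then show ?thesis using \<open>Suc (length xs) = k\<close> i by simp
      qed
      ultimately show False using least by blast
    qed
    then show ?thesis using ev e(2) by blast
  next
    case 2
    have "a \<in> gens_below G A c" "b \<in> gens_below G A c"
      using good_letters[OF Cons.prems(1)] good_letters[OF Cons.prems(2)] u by auto
    then have ab: "a = b" using inj_f 2(1) by (simp add: inj_on_def)
    then have "wp u' = wp v" using Cons.prems(3) u A by simp
    then obtain xs x y ys where e: "v = xs @ x # y # ys" "f y < f x" "wp (xs @ [x]) \<notin> flag u'"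
      using Cons.IH[of u'] good_ConsD Cons.prems(1,2) 2(2) u by blast
    have sx: "set (xs @ [x]) \<subseteq> A" using A e by simp
    have "wp ((b # xs) @ [x]) \<notin> flag u"
    proof
      assume "wp ((b # xs) @ [x]) \<in> flag u"
      then obtain k where k: "k \<le> length u" "wp ((b # xs) @ [x]) = wp (take k u)" by (rule flagE)
      have t: "take (Suc (Suc (length xs))) (b # v) = (b # xs) @ [x]" unfolding e(1) by simp
      have "Suc (Suc (length xs)) = k"
        using wp_take_eq_iff[OF rs(2,1), of "Suc (Suc (length xs))" k] k t e(1) by simp
      then obtain m where m: "k = Suc m" by blast
      have "set (take m u') \<subseteq> A" using A(2) set_take_subset by fast
      moreover have "b \<otimes> wp (xs @ [x]) = b \<otimes> wp (take m u')" using k(2) u m ab by simp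
      ultimately have "wp (xs @ [x]) = wp (take m u')"
        using wp_closed[OF sx] A(3) by simp
      moreover have "m \<le> length u'" using k(1) u m by simp
      ultimately show False using e(3) flagI by metis
    qed
    then show ?thesis using e ab by (metis append_Cons)
  qed
qed simp

section \<open>Chain-connectedness and Hurwitz-connectedness\<close>

lemma Red_good: "w \<in> Red G A c \<longleftrightarrow> good w \<and> wp w = c"
  using c_closed by (auto simp: Red_iff good_def)

lemma descent_flag:
  assumes "good (xs @ a # b # ys)" "f b < f a"
  defines "v \<equiv> xs @ a # b # ys" and "w \<equiv> xs @ b # (inv b \<otimes> a \<otimes> b) # ys"
  shows "flag v - flag w = {wp (xs @ [a])}" "\<exists>x. flag w - flag v = {x}"
proof -
  have r: "reduced v" using assms(1) goodD unfolding v_def by blast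
  have r': "reduced w" using reduced_move(1) r unfolding v_def w_def by blast
  have s: "a \<in> carrier G" "b \<in> carrier G"
    using reducedD(1)[OF r] gen_closed unfolding v_def by auto
  then have eq: "a \<otimes> b = b \<otimes> (inv b \<otimes> a \<otimes> b)" by (simp add: m_assoc)
  have ne: "a \<noteq> b" using assms(2) by blast
  show "flag v - flag w = {wp (xs @ [a])}"
    using flag_diff[OF r[unfolded v_def] r'[unfolded w_def] eq ne] unfolding v_def w_def .
  show "\<exists>x. flag w - flag v = {x}"
    using flag_diff[OF r'[unfolded w_def] r[unfolded v_def] eq[symmetric] ne[symmetric]]
    unfolding v_def w_def by blast
qed

lemmas max_chains_flag = max_chains_eq[OF c_closed finite_factor_poset[OF finite_Red]]
lemmas graded = finite_bounded_graded_factor_poset[OF c_closed finite_Red]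

lemma descent_Red: "descent v w \<Longrightarrow> v \<in> Red G A c \<Longrightarrow> w \<in> Red G A c"
  using descent_good by (simp add: Red_good)

lemma descent_chain_graph:
  assumes "descent v w" "v \<in> Red G A c"
  shows "(flag v, flag w) \<in> chain_graph (factor_poset G A c) (factor_order G A c)"
proof -
  obtain xs a b ys where e: "v = xs @ a # b # ys" "f b < f a" "w = xs @ b # (inv b \<otimes> a \<otimes> b) # ys"
    using assms(1) by (auto simp: descent_def)
  have g: "good (xs @ a # b # ys)" using assms(2) e(1) by (simp add: Red_good)
  have "flag v - flag w = {wp (xs @ [a])}" unfolding e by (rule descent_flag(1)[OF g e(2)])
  moreover obtain x where "flag w - flag v = {x}"
    using descent_flag(2)[OF g e(2)] unfolding e by blast
  ultimately show ?thesis
    unfolding chain_graph_def max_chains_flag using assms(2) descent_Red[OF assms] by simp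
qed

text \<open>Any two words descend to the same rising word. The equivalence is left arbitrary to
  cover both paths in the chain graph and Hurwitz orbits.\<close>

lemma connected_by_descents:
  assumes "u \<in> Red G A c" "v \<in> Red G A c" and "equiv (Red G A c) E"
    and "\<And>x y. x \<in> Red G A c \<Longrightarrow> descent x y \<Longrightarrow> (x, y) \<in> E"
  shows "(u, v) \<in> E"
proof -
  have path: "(x, y) \<in> E \<and> y \<in> Red G A c" if "descent\<^sup>*\<^sup>* x y" "x \<in> Red G A c" for x y
    using that
  proof (induction rule: rtranclp_induct)
    case base
    then show ?case using assms(3) by (auto simp: equiv_def refl_on_def)
  next
    case (step y z)
    then have "(x, y) \<in> E" "(y, z) \<in> E" "z \<in> Red G A c" using assms(4) descent_Red by auto
    then show ?case using assms(3) by (meson equivE transD)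
  qed
  obtain w where w: "good w" "wp w = c" "rising w" "descent\<^sup>*\<^sup>* u w"
    using rising_via_descents assms(1) unfolding Red_good by metis
  obtain w' where w': "good w'" "wp w' = c" "rising w'" "descent\<^sup>*\<^sup>* v w'"
    using rising_via_descents assms(2) unfolding Red_good by metis
  have "w = w'" using rising_unique w w' by simp
  then have "(u, w) \<in> E" "(v, w) \<in> E" using path w(4) w'(4) assms(1,2) by auto
  then show ?thesis using assms(3) by (meson equivE symD transD)
qed

lemma chain_connected_factor_poset:
  "chain_connected (factor_poset G A c) (factor_order G A c)"
proof -
  let ?C = "chain_graph (factor_poset G A c) (factor_order G A c)"
  let ?E = "{(u, v). u \<in> Red G A c \<and> v \<in> Red G A c \<and> (flag u, flag v) \<in> ?C\<^sup>*}"
  have "sym ?C" by (auto simp: sym_def chain_graph_def)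
  then have "sym (?C\<^sup>*)" by (rule sym_rtrancl)
  then have "equiv (Red G A c) ?E"
    by (intro equivI) (auto simp: refl_on_def sym_def trans_def)
  moreover have "(x, y) \<in> ?E" if "x \<in> Red G A c" "descent x y" for x y
    using that descent_Red descent_chain_graph by blast
  ultimately have "(u, v) \<in> ?E" if "u \<in> Red G A c" "v \<in> Red G A c" for u v
    using connected_by_descents that by blast
  then show ?thesis unfolding chain_connected_def max_chains_flag using graded by blast
qed

lemma hurwitz_connected: "hurwitz_connected G A c"
proof -
  let ?n = "\<ell> c"
  let ?B = "braid_group ?n" and ?R = "Red G A c"
  let ?act = "hurwitz_action G ?R"
  interpret act: group_action ?B ?R ?act
    using hurwitz_group_action[OF gens_closed gens_conj] .
  let ?E = "{(u, v). u \<in> ?R \<and> v \<in> orbit ?B ?act u}"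
  have sub: "v \<in> ?R" if "u \<in> ?R" "v \<in> orbit ?B ?act u" for u v
    using that act.element_image unfolding orbit_def by blast
  have "equiv ?R ?E"
  proof (rule equivI)
    show "?E \<subseteq> ?R \<times> ?R" using sub by blast
    show "refl_on ?R ?E" using act.orbit_refl by (auto simp: refl_on_def)
    show "sym ?E" using act.orbit_sym sub unfolding sym_def by blast
    show "trans ?E" using act.orbit_trans sub unfolding trans_def by blast
  qed
  moreover have "(x, y) \<in> ?E" if x: "x \<in> ?R" "descent x y" for x y
  proof -
    obtain xs a b ys where e: "x = xs @ a # b # ys" "y = xs @ b # (inv b \<otimes> a \<otimes> b) # ys"
      using x(2) by (auto simp: descent_def)
    \<comment> \<open>The descent is the action of a single braid generator; its index counts from
      zero, hence is \<open>length xs\<close>.\<close>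
    let ?w = "[(length xs, True)]"
    have w: "?w \<in> braid_words ?n" using x(1) e(1) by (auto simp: braid_words_def Red_def)
    have "?act (braid_class ?n ?w) x = y"
      using x(1) unfolding hurwitz_action_word[OF gens_closed gens_conj w] e
      by (simp add: move_split(1) del: hurwitz_move.simps)
    then show ?thesis using w x(1) by (auto simp: orbit_def braid_class_carrier)
  qed
  ultimately have "(u, v) \<in> ?E" if "u \<in> ?R" "v \<in> ?R" for u v
    using connected_by_descents that by blast
  then have "\<exists>g \<in> carrier ?B. ?act g u = v" if "u \<in> ?R" "v \<in> ?R" for u v
    using that unfolding orbit_def by blast
  then show ?thesis
    unfolding hurwitz_connected_def transitive_action_def transitive_action_axioms_def
    using act.group_action_axioms by blast
qed

section \<open>Shellability\<close>

lemma shellable_factor_poset: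
  "shellable (factor_poset G A c) (factor_order G A c)"
proof -
  let ?R = "Red G A c"
  \<comment> \<open>The lexicographic order of words, transported to chains; this is sound because
    \<open>flag\<close> is injective on \<open>Red G A c\<close>.\<close>
  define L where "L = {(flag u, flag v) | u v. u \<in> ?R \<and> v \<in> ?R \<and> (u = v \<or> lex_less u v)}"
  have inj: "u = v" if "u \<in> ?R" "v \<in> ?R" "flag u = flag v" for u v
  proof -
    have "reduced u" "reduced v" "wp u = wp v" using that by (simp_all add: Red_iff)
    then show ?thesis using flag_inj[of u v] that(3) reducedD(2) by metis
  qed
  have L_iff: "(flag u, flag v) \<in> L \<longleftrightarrow> u = v \<or> lex_less u v" if "u \<in> ?R" "v \<in> ?R" for u v
  proof
    assume "(flag u, flag v) \<in> L"
    then obtain u' v' where "u' \<in> ?R" "v' \<in> ?R" "flag u = flag u'" "flag v = flag v'"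
      "u' = v' \<or> lex_less u' v'" unfolding L_def by blast
    then show "u = v \<or> lex_less u v" using inj that by metis
  qed (use that in \<open>auto simp: L_def\<close>)
  have "linear_order_on (flag ` ?R) L"
    unfolding linear_order_on_def partial_order_on_def preorder_on_def
  proof (intro conjI)
    show "L \<subseteq> flag ` ?R \<times> flag ` ?R" by (auto simp: L_def)
    show "refl_on (flag ` ?R) L" by (auto simp: refl_on_def L_iff)
    show "trans L"
    proof (rule transI)
      fix x y z assume "(x, y) \<in> L" "(y, z) \<in> L"
      moreover from this obtain u v w where uvw: "u \<in> ?R" "v \<in> ?R" "w \<in> ?R"
        "x = flag u" "y = flag v" "z = flag w" unfolding L_def by blast
      ultimately show "(x, z) \<in> L" using L_iff lex_trans by metis
    qed
    show "antisym L"
    proof (rule antisymI)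
      fix x y assume "(x, y) \<in> L" "(y, x) \<in> L"
      moreover from this obtain u v where uv: "u \<in> ?R" "v \<in> ?R" "x = flag u" "y = flag v"
        unfolding L_def by blast
      ultimately show "x = y" using L_iff lex_trans lex_irrefl by metis
    qed
    show "total_on (flag ` ?R) L"
    proof (rule total_onI)
      fix x y assume "x \<in> flag ` ?R" "y \<in> flag ` ?R" "x \<noteq> y"
      moreover from this obtain u v where uv: "u \<in> ?R" "v \<in> ?R" "x = flag u" "y = flag v"
        by blast
      moreover from uv have "good u" "good v" by (simp_all add: Red_good)
      ultimately show "(x, y) \<in> L \<or> (y, x) \<in> L" using L_iff lex_total by metis
    qed
  qed
  moreover have "\<exists>N x. (N, M') \<in> L \<and> N \<noteq> M' \<and> x \<in> M' \<and> M \<inter> M' \<subseteq> N \<inter> M' \<and> N \<inter> M' = M' - {x}"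
    if M: "(M, M') \<in> L" "M \<noteq> M'" for M M'
  proof -
    obtain u v where uv: "u \<in> ?R" "v \<in> ?R" "M = flag u" "M' = flag v" "lex_less u v"
      using M unfolding L_def by blast
    then have g: "good u" "good v" "wp u = wp v" by (simp_all add: Red_good)
    obtain xs a b ys where e: "v = xs @ a # b # ys" "f b < f a" "wp (xs @ [a]) \<notin> flag u"
      using shelling_descent[OF g uv(5)] by blast
    \<comment> \<open>The required chain \<open>N\<close> is the flag of the word after the descent:
      it precedes \<open>M'\<close> and misses exactly \<open>wp (xs @ [a])\<close> from it.\<close>
    let ?w = "xs @ b # (inv b \<otimes> a \<otimes> b) # ys"
    have d: "descent v ?w" using e by (auto simp: descent_def)
    have diff: "flag v - flag ?w = {wp (xs @ [a])}" 
      using descent_flag(1)[of xs a b ys] g(2) e(2) unfolding e(1) by blast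
    have "(flag ?w, flag v) \<in> L" 
      using L_iff[OF descent_Red[OF d uv(2)] uv(2)] descent_lex[OF d] by blast
    moreover have "flag ?w \<noteq> flag v" "wp (xs @ [a]) \<in> flag v"
      "flag ?w \<inter> flag v = flag v - {wp (xs @ [a])}"
      using diff by blast+
    \<comment> \<open>The one element of \<open>flag v\<close> missing from \<open>flag ?w\<close>
      is missing from \<open>flag u\<close> as well.\<close>
    moreover have "flag u \<inter> flag v \<subseteq> flag ?w \<inter> flag v"
    proof
      fix x assume x: "x \<in> flag u \<inter> flag v"
      then have "x \<notin> flag v - flag ?w" using e(3) unfolding diff by auto
      then show "x \<in> flag ?w \<inter> flag v" using x by blast
    qed
    ultimately show ?thesis unfolding uv(3,4) by metis
  qed
  ultimately show ?thesis unfolding shellable_def max_chains_flag using graded by blast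
qed

end

section \<open>Passage from the linear order to a rank function, and the theorem\<close>

lemma linear_order_nat_rank:
  assumes "finite B" "linear_order_on B r"
  obtains f :: "'a \<Rightarrow> nat" where "\<And>a b. a \<in> B \<Longrightarrow> b \<in> B \<Longrightarrow> f a \<le> f b \<longleftrightarrow> (a, b) \<in> r"
proof
  \<comment> \<open>The rank counts predecessors; along a strict step the set of predecessors grows
    strictly.\<close>
  let ?f = "\<lambda>a. card {b. (b, a) \<in> r}"
  have r: "r \<subseteq> B \<times> B" "refl_on B r" "trans r" "antisym r" "total_on B r"
    using assms(2) by (auto simp: linear_order_on_def partial_order_on_def preorder_on_def)
  have fin: "finite {b. (b, a) \<in> r}" for a
    by (rule finite_subset[OF _ assms(1)]) (use r(1) in blast)
  fix a b assume ab: "a \<in> B" "b \<in> B"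
  show "?f a \<le> ?f b \<longleftrightarrow> (a, b) \<in> r"
  proof
    assume "(a, b) \<in> r"
    then show "?f a \<le> ?f b" by (intro card_mono fin) (use r(3) in \<open>auto dest: transD\<close>)
  next
    assume le: "?f a \<le> ?f b"
    show "(a, b) \<in> r"
    proof (rule ccontr)
      assume n: "(a, b) \<notin> r"
      have "a \<noteq> b" using n r(2) ab(1) unfolding refl_on_def by blast
      then have "(b, a) \<in> r" using n r(5) ab unfolding total_on_def by blast
      moreover have "(a, a) \<in> r" using r(2) ab by (auto simp: refl_on_def)
      ultimately have "{x. (x, b) \<in> r} \<subset> {x. (x, a) \<in> r}"
        using n r(3) by (auto dest: transD)
      then have "?f b < ?f a" by (intro psubset_card_mono fin)
      then show False using le by simp
    qed
  qed
qed

theorem theorem1p1: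
  fixes G :: "('a, 'b) monoid_scheme" and A :: "'a set" and c :: 'a and r :: "'a rel"
  assumes "group G"
    and "A \<subseteq> carrier G"
    and "\<Inter>{H. submonoid H G \<and> A \<subseteq> H} = carrier G"
    and "\<forall>a \<in> A. \<forall>g \<in> carrier G. g \<otimes>\<^bsub>G\<^esub> a \<otimes>\<^bsub>G\<^esub> inv\<^bsub>G\<^esub> g \<in> A"
    and "c \<in> carrier G"
    and "finite (Red G A c)"
    and "compatible_order G A c r"
    and "totally_well_covered G A c r"
  shows "chain_connected (factor_poset G A c) (factor_order G A c) \<and>
         hurwitz_connected G A c \<and>
         shellable (factor_poset G A c) (factor_order G A c)"
proof -
  interpret conj_generated G A
    using assms(1-4) by (simp add: conj_generated_def conj_generated_axioms_def)
  let ?B = "gens_below G A c"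
  have "?B \<subseteq> factor_poset G A c" by (auto simp: gens_below_def factor_poset_iff)
  then have "finite ?B" using finite_factor_poset[OF assms(6)] finite_subset by blast
  moreover have "linear_order_on ?B r" using assms(7) by (simp add: compatible_order_def)
  ultimately obtain f :: "'a \<Rightarrow> nat"
    where f: "\<And>a b. a \<in> ?B \<Longrightarrow> b \<in> ?B \<Longrightarrow> f a \<le> f b \<longleftrightarrow> (a, b) \<in> r"
    using linear_order_nat_rank by blast
  have anti: "antisym r"
    using \<open>linear_order_on ?B r\<close> by (simp add: linear_order_on_def partial_order_on_def)
  \<comment> \<open>The rank \<open>f\<close> represents \<open>r\<close> only on the generators
    below \<open>c\<close>, so the letters have to be placed there first.\<close>
  have letters: "a \<in> ?B \<and> b \<in> ?B" if ab: "reduced [a, b]" "wp [a, b] \<preceq> c" for a b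
  proof -
    have r: "reduced ([a] @ [b])" and A: "a \<in> A" "b \<in> A"
      using ab(1) reducedD(1)[OF ab(1)] by simp_all
    have "a \<preceq> wp [a, b]" "b \<preceq> wp [a, b]"
      using below_append[OF r] suffix_below_append[OF r] A by simp_all
    then show ?thesis using A ab(2) below_trans unfolding gens_below_def by blast
  qed
  interpret compatible_well_covered G A c f
  proof
    show "c \<in> carrier G" "finite (Red G A c)" by fact+
    show "inj_on f ?B"
    proof (rule inj_onI)
      fix a b assume "a \<in> ?B" "b \<in> ?B" "f a = f b"
      then show "a = b" using f[of a b] f[of b a] anti by (auto dest: antisymD)
    qed
  next
    fix a b a' b'
    assume ab: "reduced [a, b]" "reduced [a', b']" "wp [a, b] \<preceq> c" "wp [a, b] = wp [a', b']"
      "f a \<le> f b" "f a' \<le> f b'"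
    have "(a, b) \<in> r" "(a', b') \<in> r" using letters f ab by metis+
    moreover have "[a, b] \<in> Red G A (wp [a, b])" "[a', b'] \<in> Red G A (wp [a, b])"
      using ab(1,2,4) by (simp_all only: Red_iff)
    moreover have "\<ell> (wp [a, b]) = 2" using reducedD(2)[OF ab(1)] by simp
    then have "\<exists>!p. case p of (x, y) \<Rightarrow> [x, y] \<in> Red G A (wp [a, b]) \<and> (x, y) \<in> r"
      using assms(7) ab(3) by (simp only: compatible_order_def)
    ultimately have "(a, b) = (a', b')" by (auto elim!: ex1E)
    then show "a = a'" by simp
  next
    fix g a b
    assume g: "g \<preceq> c" and ab: "a \<in> gens_below G A g" "b \<in> gens_below G A g" "f b < f a"
    have sub: "gens_below G A g \<subseteq> ?B" using below_trans[OF _ g] by (auto simp: gens_below_def)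
    let ?r = "Restr r (gens_below G A g)"
    \<comment> \<open>So \<open>a\<close> is not least in the restricted order, and well-coveredness
      of the interval below \<open>g\<close> makes its cover set nonempty.\<close>
    have "(a, b) \<notin> r" using f[of a b] ab sub by auto
    then have "\<not> (\<forall>b \<in> gens_below G A g. (a, b) \<in> ?r)" using ab(2) by blast
    moreover have "well_covered G A g ?r"
      using assms(8) g by (simp add: totally_well_covered_def factor_poset_iff)
    ultimately have "cover_set G A g ?r a \<noteq> {}" using ab(1) unfolding well_covered_def by blast
    then obtain h a' where h: "prefix_cover G A a h" "h \<preceq> g" "a' \<in> gens_below G A g"
        "(a', a) \<in> r" "a' \<noteq> a" "prefix_cover G A a' h"
      unfolding cover_set_def by blast
    have "\<not> f a \<le> f a'" using f[of a a'] h(3-5) ab(1) sub anti by (auto dest: antisymD)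
    then show "\<exists>a' \<in> gens_below G A g. \<exists>h. f a' < f a \<and> h \<preceq> g \<and>
        prefix_cover G A a h \<and> prefix_cover G A a' h"
      using h by (meson not_le)
  qed
  show ?thesis
    using chain_connected_factor_poset hurwitz_connected shellable_factor_poset by blast
qed

end
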